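(* Let $m\geq 2$ be a positive integer and let $R\cong \prod_{i=1}^{m}R_{i}$, where for every $1\leq i\leq m$, $R_{i}$ is a local Artinian principal ideal ring that is not a field. Put $n_{i}=|I(R_{i})|$ for $1\leq i\leq m$. Then $sdim(In(R))=\prod_{i=1}^{m}(n_{i}+2)-\sum_{i=1}^{m}n_{i}-m-1$.
   Context: All rings are commutative with identity. $I(R)$ denotes the set of non-trivial ideals of $R$ (ideals different from $0$ and $R$). The inclusion ideal graph $In(R)$ is the simple graph with vertex set $I(R)$, two distinct vertices being adjacent if and only if one of them is properly contained in the other. A local Artinian principal ideal ring has only finitely many ideals, and they are totally ordered by inclusion. For a graph $G$ with distance $d$, two vertices $u,v$ are strongly resolved by a vertex $w$ if $d(w,u)=d(w,v)+d(v,u)$ or $d(w,v)=d(w,u)+d(u,v)$. A set $W\subseteq V(G)$ is a strong resolving set if every two distinct vertices of $G$ are strongly resolved by some vertex of $W$. The strong metric dimension $sdim(G)$ is the minimum cardinality of a strong resolving set. *)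

theory Defs
  imports
    "HOL-Algebra.Algebra"
    "Graph_Theory.Shortest_Path"
    "Graph_Theory.Pair_Digraph"
begin

locale local_ring = cring +
  assumes unique_maximal: "\<exists>!M. maximalideal M R"

locale artinian_ring = cring +
  assumes descending_chain:
    "\<And>C :: nat \<Rightarrow> 'a set. \<lbrakk> \<And>k. ideal (C k) R; \<And>k. C (Suc k) \<subseteq> C k \<rbrakk>
      \<Longrightarrow> \<exists>N. \<forall>k\<ge>N. C k = C N"

locale principal_ideal_ring = cring +
  assumes all_principal: "ideal I R \<Longrightarrow> principalideal I R"

locale local_artinian_pir = local_ring + artinian_ring + principal_ideal_ring

definition nontrivial_ideals :: "('a, 'r) ring_scheme \<Rightarrow> 'a set set" where
  "nontrivial_ideals R = {I. ideal I R \<and> I \<noteq> {\<zero>\<^bsub>R\<^esub>} \<and> I \<noteq> carrier R}"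

text \<open>A simple graph is represented by a loopfree digraph without parallel arcs that contains,
  with every arc, also the reversed one.\<close>

definition inclusion_ideal_graph :: "('a, 'r) ring_scheme \<Rightarrow> 'a set pair_pre_digraph" where
  "inclusion_ideal_graph R =
    \<lparr> pverts = nontrivial_ideals R,
      parcs = {(I, J). I \<in> nontrivial_ideals R \<and> J \<in> nontrivial_ideals R \<and> (I \<subset> J \<or> J \<subset> I)} \<rparr>"

lemma wf_inclusion_ideal_graph: "wf_digraph (with_proj (inclusion_ideal_graph R))"
  by unfold_locales (auto simp: inclusion_ideal_graph_def)

lemma loopfree_inclusion_ideal_graph:
  "loopfree_digraph (with_proj (inclusion_ideal_graph R))"
  by unfold_locales (auto simp: inclusion_ideal_graph_def)

lemma symmetric_inclusion_ideal_graph: "symmetric (with_proj (inclusion_ideal_graph R))"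
  by (auto simp: symmetric_def inclusion_ideal_graph_def arcs_ends_def arc_to_ends_def sym_def)

text \<open>The number of arcs on a shortest walk, and \<open>\<infinity>\<close> if there is no walk at all.\<close>

definition graph_dist :: "('v, 'e) pre_digraph \<Rightarrow> 'v \<Rightarrow> 'v \<Rightarrow> ereal" where
  "graph_dist G u v = wf_digraph.\<mu> G (\<lambda>_. 1) u v"

definition strongly_resolves :: "('v, 'e) pre_digraph \<Rightarrow> 'v \<Rightarrow> 'v \<Rightarrow> 'v \<Rightarrow> bool" where
  "strongly_resolves G w u v \<longleftrightarrow>
    graph_dist G w u = graph_dist G w v + graph_dist G v u \<or>
    graph_dist G w v = graph_dist G w u + graph_dist G u v"

definition strong_resolving_set :: "('v, 'e) pre_digraph \<Rightarrow> 'v set \<Rightarrow> bool" where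
  "strong_resolving_set G W \<longleftrightarrow>
    W \<subseteq> verts G \<and>
    (\<forall>u\<in>verts G. \<forall>v\<in>verts G. u \<noteq> v \<longrightarrow> (\<exists>w\<in>W. strongly_resolves G w u v))"

text \<open>Meaningful for graphs having a finite strong resolving set, in particular for all finite
  graphs: there the set of all vertices is one.\<close>

definition sdim :: "('v, 'e) pre_digraph \<Rightarrow> nat" where
  "sdim G = (LEAST k. \<exists>W. finite W \<and> strong_resolving_set G W \<and> card W = k)"

end

(* Ideals of R correspond to tuples in a product of chains {0..L i} with L i = n i + 1 >= 2, ordered
   componentwise. All distances in the graph are at most 3, and distance 3 occurs exactly between
   complementary tuples E A and E (I - A), where E A is L i on A and 0 elsewhere.

   Upper bound: the complement of a maximal chain of proper tuples resolves, since two comparable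
   vertices always have a vertex comparable to exactly one of them.

   Lower bound: let S be the complement of a resolving set. Two incomparable members u, v of S must
   be such that u = E A and v is comparable to E (I - A), or vice versa, and S contains no
   complementary pair. So the members of S of the form E A define pairwise compatible splits of the
   index set, while the other members form a chain in which every element lies on one side of each
   split or dominates one. A split is crossed at one step of this chain, extended by bottom and top,
   and a step crossing p splits raises the rank by at least p + 1, because the compatible splits
   crossed there form a laminar family. As the total rank is the sum of the L i, |S| is at most
   that sum minus 1. *)

theory Submission
  imports Defs
begin

section \<open>Splits and chains in a product of chains\<close>

text \<open>Induction on the points of \<open>U\<close>. Removing \<open>x\<close> from all members
  loses only \<open>{x}\<close> itself and merges the pairs \<open>B\<close>,
  \<open>B - {x}\<close>. Laminarity allows at most one such pair, so a new point costs at most two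
  members.\<close>

lemma card_laminar_family_le:
  assumes "finite U" "F \<subseteq> Pow U" "{} \<notin> F"
    and "\<And>A B. A \<in> F \<Longrightarrow> B \<in> F \<Longrightarrow> A \<subseteq> B \<or> B \<subseteq> A \<or> A \<inter> B = {}"
  shows "card F \<le> 2 * card U - 1"
  using assms
proof (induction U arbitrary: F rule: finite_induct)
  case empty
  then have "F = {}" by auto
  then show ?case by simp
next
  case (insert x U)
  note lam = insert.prems(3)
  have finF: "finite F"
    using insert.prems(1) insert.hyps(1) by (meson finite.insertI finite_Pow_iff finite_subset)
  show ?case
  \<comment> \<open>Truncated subtraction makes the bound for the empty set 0 instead of -1, so
    adding two would be too weak here and a one-point set is counted directly.\<close>
  proof (cases "U = {}")
    case True
    then have "F \<subseteq> {{x}}" using insert.prems(1,2) by (auto dest: subset_singletonD)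
    then have "card F \<le> card {{x}}" by (intro card_mono) auto
    then show ?thesis using True by simp
  next
    case False
    define F' where "F' = (\<lambda>B. B - {x}) ` F - {{}}"
    \<comment> \<open>\<open>K\<close> holds the larger sets of the pairs that merge. Two sets in
      \<open>K\<close> share \<open>x\<close> and are therefore nested; comparing the larger one
      without \<open>x\<close> with the smaller one forces them to be equal.\<close>
    define K where "K = {B \<in> F. x \<in> B \<and> B - {x} \<in> F}"
    have F': "card F' \<le> 2 * card U - 1"
    proof (rule insert.IH)
      show "F' \<subseteq> Pow U" using insert.prems(1) by (auto simp: F'_def)
      show "{} \<notin> F'" by (auto simp: F'_def)
      show "A \<subseteq> B \<or> B \<subseteq> A \<or> A \<inter> B = {}" if "A \<in> F'" "B \<in> F'" for A B
        using that lam unfolding F'_def by fast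
    qed
    have K: "card K \<le> 1"
    proof -
      have "B = C" if "B \<in> K" "C \<in> K" for B C
      proof -
        have "B - {x} \<noteq> {}" "C - {x} \<noteq> {}" using that insert.prems(2) unfolding K_def by (metis (mono_tags, lifting) mem_Collect_eq)+
        moreover have "B \<subseteq> C - {x} \<or> C - {x} \<subseteq> B \<or> B \<inter> (C - {x}) = {}"
          "C \<subseteq> B - {x} \<or> B - {x} \<subseteq> C \<or> C \<inter> (B - {x}) = {}"
          "B \<subseteq> C \<or> C \<subseteq> B \<or> B \<inter> C = {}"
          using that lam by (auto simp: K_def)
        moreover have "x \<in> B" "x \<in> C" using that by (auto simp: K_def)
        ultimately show ?thesis by blast
      qed
      moreover have "finite K" using finF by (simp add: K_def)
      ultimately show ?thesis by (metis One_nat_def card_le_Suc0_iff_eq)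
    qed
    have "card (F - (K \<union> {{x}})) \<le> card F'"
    proof (rule card_inj_on_le)
      show "inj_on (\<lambda>B. B - {x}) (F - (K \<union> {{x}}))"
      proof (rule inj_onI)
        fix B C assume B: "B \<in> F - (K \<union> {{x}})" and C: "C \<in> F - (K \<union> {{x}})"
          and eq: "B - {x} = C - {x}"
        show "B = C"
        proof (cases "x \<in> B \<longleftrightarrow> x \<in> C")
          case True then show ?thesis using eq by blast
        next
          case False
          then consider "x \<in> B" "x \<notin> C" | "x \<notin> B" "x \<in> C" by blast
          then show ?thesis
          proof cases
            case 1
            then have "B - {x} = C" using eq by simp
            then show ?thesis using 1 B C by (auto simp: K_def)
          next
            case 2
            then have "C - {x} = B" using eq by simp
            then show ?thesis using 2 B C by (auto simp: K_def)
          qed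
        qed
      qed
      show "(\<lambda>B. B - {x}) ` (F - (K \<union> {{x}})) \<subseteq> F'"
        using insert.prems(2) by (auto simp: F'_def dest: subset_singletonD)
      show "finite F'" using finF by (simp add: F'_def)
    qed
    moreover have "card F \<le> card (F - (K \<union> {{x}})) + card (K \<union> {{x}})"
      using finF card_mono[of "(F - (K \<union> {{x}})) \<union> (K \<union> {{x}})" F]
        card_Un_le[of "F - (K \<union> {{x}})" "K \<union> {{x}}"] by (force simp: K_def)
    moreover have "card (K \<union> {{x}}) \<le> 2" using K card_Un_le[of K "{{x}}"] by simp
    moreover have "card U \<ge> 1" using False insert.hyps(1) by (simp add: Suc_leI card_gt_0_iff)
    ultimately show ?thesis using F' insert.hyps by simp
  qed
qed

section \<open>Tuples in a product of chains, and splits of the index set\<close>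

locale chain_product =
  fixes m :: nat and L :: "nat \<Rightarrow> nat"
  assumes m_ge: "m \<ge> 2" and L_ge: "i \<in> {1..m} \<Longrightarrow> L i \<ge> 2"
begin

abbreviation "I \<equiv> {1..m}"

definition tuples :: "(nat \<Rightarrow> nat) set" where
  "tuples = (\<Pi>\<^sub>E i\<in>I. {..L i})"

definition rank :: "(nat \<Rightarrow> nat) \<Rightarrow> nat" where
  "rank u = (\<Sum>i\<in>I. u i)"

definition E :: "nat set \<Rightarrow> nat \<Rightarrow> nat" where
  "E A = (\<lambda>i\<in>I. if i \<in> A then L i else 0)"

definition supp :: "(nat \<Rightarrow> nat) \<Rightarrow> nat set" where
  "supp u = {i \<in> I. u i > 0}"

definition tops :: "(nat \<Rightarrow> nat) \<Rightarrow> nat set" where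
  "tops u = {i \<in> I. u i = L i}"

text \<open>For a tuple \<open>u\<close> and \<open>A\<close> inside \<open>I\<close>, this says
  that \<open>u\<close> lies below \<open>E A\<close> or below \<open>E (I - A)\<close>;
  \<open>high\<close> is the dual condition. Both are symmetric in \<open>A\<close> and
  \<open>I - A\<close>, so they depend on the split and not on the chosen side.\<close>

definition low :: "nat set \<Rightarrow> (nat \<Rightarrow> nat) \<Rightarrow> bool" where
  "low A u \<longleftrightarrow> supp u \<subseteq> A \<or> supp u \<inter> A = {}"

definition high :: "nat set \<Rightarrow> (nat \<Rightarrow> nat) \<Rightarrow> bool" where
  "high A u \<longleftrightarrow> A \<subseteq> tops u \<or> I - A \<subseteq> tops u"

text \<open>Bottom \<open>E {}\<close> and top \<open>E I\<close> count as regular, so that they can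
  serve as the ends of a chain of regular tuples.\<close>

definition regular :: "(nat \<Rightarrow> nat) \<Rightarrow> bool" where
  "regular u \<longleftrightarrow> (\<forall>A\<subseteq>I. A \<noteq> {} \<longrightarrow> A \<noteq> I \<longrightarrow> u \<noteq> E A)"

text \<open>The clause on \<open>I - A\<close> means that a split is represented by only one of its
  sides. The last clause is compatibility of two splits: one of the four intersections of their
  sides is empty.\<close>

definition cross_free :: "nat set set \<Rightarrow> bool" where
  "cross_free F \<longleftrightarrow> F \<subseteq> Pow I - {{}, I} \<and> (\<forall>A\<in>F. I - A \<notin> F) \<and>
     (\<forall>A\<in>F. \<forall>B\<in>F. A \<subseteq> B \<or> B \<subseteq> A \<or> A \<inter> B = {} \<or> A \<union> B = I)"

lemma finite_tuples: "finite tuples"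
  by (auto simp: tuples_def intro!: finite_PiE)

text \<open>Tuples are extensional functions and agree outside \<open>I\<close>, so the pointwise
  order on all of \<open>nat\<close> is decided on \<open>I\<close>.\<close>

lemma tuples_le_iff: "u \<in> tuples \<Longrightarrow> v \<in> tuples \<Longrightarrow> u \<le> v \<longleftrightarrow> (\<forall>i\<in>I. u i \<le> v i)"
  unfolding le_fun_def tuples_def by (metis PiE_arb order_refl)

lemma tuples_eqI: "u \<in> tuples \<Longrightarrow> v \<in> tuples \<Longrightarrow> (\<And>i. i \<in> I \<Longrightarrow> u i = v i) \<Longrightarrow> u = v"
  unfolding tuples_def by (rule PiE_ext)

lemma tuples_le_L: "u \<in> tuples \<Longrightarrow> i \<in> I \<Longrightarrow> u i \<le> L i"
  by (auto simp: tuples_def)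

lemma E_tuples: "E A \<in> tuples"
  by (auto simp: E_def tuples_def)

lemma E_nth: "i \<in> I \<Longrightarrow> E A i = (if i \<in> A then L i else 0)"
  by (simp add: E_def)

lemma L_pos: "i \<in> I \<Longrightarrow> L i > 0"
  using L_ge[of i] by linarith

lemma E_inj: "A \<subseteq> I \<Longrightarrow> B \<subseteq> I \<Longrightarrow> E A = E B \<longleftrightarrow> A = B"
proof
  assume "A \<subseteq> I" "B \<subseteq> I" "E A = E B"
  then have "i \<in> A \<longleftrightarrow> i \<in> B" if "i \<in> I" for i
    using E_nth[OF that, of A] E_nth[OF that, of B] L_pos[OF that] by (metis less_numeral_extra(3))
  then show "A = B" using \<open>A \<subseteq> I\<close> \<open>B \<subseteq> I\<close> by blast
qed simp

lemma E_empty_le: "u \<in> tuples \<Longrightarrow> E {} \<le> u"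
  by (simp add: tuples_le_iff E_tuples E_nth)

lemma le_E_I: "u \<in> tuples \<Longrightarrow> u \<le> E I"
  by (simp add: tuples_le_iff E_tuples E_nth tuples_le_L)

lemma le_E_iff: "u \<in> tuples \<Longrightarrow> u \<le> E A \<longleftrightarrow> supp u \<subseteq> A"
  by (auto simp: tuples_le_iff E_tuples E_nth supp_def tuples_le_L split: if_splits)

lemma E_le_iff: "u \<in> tuples \<Longrightarrow> A \<subseteq> I \<Longrightarrow> E A \<le> u \<longleftrightarrow> A \<subseteq> tops u"
  using tuples_le_L[of u] by (fastforce simp: tuples_le_iff E_tuples E_nth tops_def)

lemma supp_E: "A \<subseteq> I \<Longrightarrow> supp (E A) = A"
  using L_pos by (auto simp: supp_def E_nth split: if_splits)

lemma tops_E: "A \<subseteq> I \<Longrightarrow> tops (E A) = A"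
  using L_pos by (force simp: tops_def E_nth split: if_splits)

lemma rank_strict_mono:
  assumes "u \<in> tuples" "v \<in> tuples" "u < v"
  shows "rank u < rank v"
  unfolding rank_def
proof (rule sum_strict_mono_ex1)
  show "\<forall>i\<in>I. u i \<le> v i" using assms tuples_le_iff[of u v] by (simp add: less_imp_le)
  show "\<exists>i\<in>I. u i < v i"
    using assms tuples_le_iff[of v u] by (metis leD linorder_not_less)
qed simp

text \<open>A tuple with values only 0 and \<open>L i\<close> equals \<open>E (tops u)\<close>,
  which regularity permits for bottom and top alone.\<close>

lemma regular_strict:
  assumes "u \<in> tuples" "regular u" "u \<noteq> E {}" "u \<noteq> E I"
  obtains i where "i \<in> I" "0 < u i" "u i < L i"
proof (rule ccontr)
  assume "\<not> thesis"
  then have "\<forall>i\<in>I. \<not> (0 < u i \<and> u i < L i)" using that by blast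
  then have "u i = 0 \<or> u i = L i" if "i \<in> I" for i
    using that tuples_le_L[OF assms(1) that] by force
  then have "u = E (tops u)"
    by (intro tuples_eqI assms E_tuples) (auto simp: E_nth tops_def)
  moreover have "tops u \<subseteq> I" by (auto simp: tops_def)
  ultimately show False using assms unfolding regular_def by metis
qed

lemma rank_diff_ge:
  assumes "u \<in> tuples" "v \<in> tuples" "u \<le> v" "\<And>i. i \<in> I \<Longrightarrow> g i + u i \<le> v i"
  shows "rank u + (\<Sum>i\<in>I. g i) \<le> rank v"
proof -
  have "(\<Sum>i\<in>I. g i + u i) \<le> (\<Sum>i\<in>I. v i)" by (rule sum_mono) (rule assms(4))
  then show ?thesis by (simp add: rank_def sum.distrib)
qed

text \<open>Of the two sides of a split the one avoiding a fixed point is chosen, which turns the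
  splits into a laminar family. If it lives on the coordinates where the step from u to v climbs
  from 0 to the top, each of these contributes at least 2 to the rank.\<close>

lemma step_bound:
  assumes F: "cross_free F" and u: "u \<in> tuples" "regular u" and v: "v \<in> tuples" "regular v"
    and less: "u < v"
  shows "card {A \<in> F. low A u \<and> high A v} + 1 + rank u \<le> rank v"
proof -
  define Z where "Z = supp u"
  define T where "T = tops v"
  define Q where "Q = {A \<in> F. low A u \<and> high A v}"
  have ZI: "Z \<subseteq> I" and TI: "T \<subseteq> I" by (auto simp: Z_def T_def supp_def tops_def)
  have le: "u \<le> v" using less by simp
  have finT: "finite (T - Z)" using TI by (meson finite_Diff finite_atLeastAtMost finite_subset)
  have QD: "A \<subseteq> I" "A \<noteq> {}" "A \<noteq> I" "I - A \<notin> Q" "Z \<subseteq> A \<or> Z \<inter> A = {}" "A \<subseteq> T \<or> I - A \<subseteq> T"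
    if "A \<in> Q" for A
    using that F by (auto simp: Q_def cross_free_def low_def high_def Z_def T_def)
  have cross: "A \<subseteq> B \<or> B \<subseteq> A \<or> A \<inter> B = {} \<or> A \<union> B = I" if "A \<in> Q" "B \<in> Q" for A B
    using that F by (auto simp: Q_def cross_free_def)
  have le_i: "u i \<le> v i" if "i \<in> I" for i using le that by (simp add: le_funD)
  have jump: "2 + u i \<le> v i" if "i \<in> T - Z" for i
    using that L_ge[of i] by (auto simp: T_def Z_def tops_def supp_def)
  define side where "side r A = (if r \<in> A then I - A else A)" for r and A :: "nat set"
  have side_inj: "inj_on (side r) Q" for r
  proof (rule inj_onI)
    fix A B assume AB: "A \<in> Q" "B \<in> Q" "side r A = side r B"
    have "A = B \<or> A = I - B"
      using AB QD(1)[OF AB(1)] QD(1)[OF AB(2)] unfolding side_def by (auto split: if_splits)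
    then show "A = B" using QD(4)[OF AB(2)] AB(1) by auto
  qed
  \<comment> \<open>Two sides that both miss \<open>r\<close> cannot cover \<open>I\<close>, so the
    alternative \<open>A \<union> B = I\<close> of cross-freeness drops out and laminarity
    remains.\<close>
  have side_lam: "side r A \<subseteq> side r B \<or> side r B \<subseteq> side r A \<or> side r A \<inter> side r B = {}"
    if "r \<in> I" "A \<in> Q" "B \<in> Q" for r A B
    using cross[OF that(2,3)] QD(1)[OF that(2)] QD(1)[OF that(3)] that(1)
    unfolding side_def by (auto split: if_splits)
  have side_ne: "side r A \<noteq> {}" "r \<notin> side r A" "side r A \<subseteq> I" if "A \<in> Q" for r A
    using QD(1-3)[OF that] by (auto simp: side_def)
  have rank_lt: "rank u < rank v" using rank_strict_mono u v less by blast
  have "card Q + 1 + rank u \<le> rank v"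
  \<comment> \<open>A point \<open>r\<close> in \<open>Z\<close> forces the chosen sides to miss
    \<open>Z\<close>, and a point \<open>r\<close> outside \<open>T\<close> forces them into
    \<open>T\<close>. In these cases one point achieves both, or one of the two demands is void, so
    all sides lie in \<open>T - Z\<close>.\<close>
  proof (cases "Z = {} \<or> T = I \<or> \<not> Z \<subseteq> T")
    case True
    obtain r where r: "r \<in> I" "\<And>A. A \<in> Q \<Longrightarrow> side r A \<subseteq> T - Z"
    proof -
      consider "Z = {}" "T = I" | "Z = {}" "T \<noteq> I" | "Z \<noteq> {}" "T = I" | "\<not> Z \<subseteq> T" using True by blast
      then show thesis
      proof cases
        case 1
        have "1 \<in> I" using m_ge by auto
        then show thesis using 1 side_ne(3) by (intro that[of 1]) auto
      next
        case 2
        then obtain r where "r \<in> I - T" using TI by blast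
        moreover have "side r A \<subseteq> T - Z" if "A \<in> Q" for A
          using \<open>r \<in> I - T\<close> QD(6)[OF that] 2 unfolding side_def
          by (simp only: Diff_empty split: if_split) blast
        ultimately show thesis using that by blast
      next
        case 3
        then obtain r where "r \<in> Z" by blast
        moreover have "side r A \<subseteq> T - Z" if "A \<in> Q" for A
          using \<open>r \<in> Z\<close> QD(5)[OF that] QD(1)[OF that] 3 by (auto simp: side_def)
        ultimately show thesis using that ZI by blast
      next
        case 4
        then obtain r where "r \<in> Z - T" by blast
        moreover have "side r A \<subseteq> T - Z" if "A \<in> Q" for A
          using \<open>r \<in> Z - T\<close> QD(5,6)[OF that] QD(1)[OF that] ZI by (auto simp: side_def)
        ultimately show thesis using that ZI by blast
      qed
    qed
    have "card Q = card (side r ` Q)" using side_inj by (simp add: card_image)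
    also have "\<dots> \<le> 2 * card (T - Z) - 1"
    proof (rule card_laminar_family_le[OF finT])
      show "side r ` Q \<subseteq> Pow (T - Z)" using r by auto
      show "{} \<notin> side r ` Q" using side_ne(1) by (metis imageE)
    qed (use side_lam[OF r(1)] in auto)
    finally have c: "card Q \<le> 2 * card (T - Z) - 1" .
    have "rank u + (\<Sum>i\<in>I. if i \<in> T - Z then 2 else 0) \<le> rank v"
      by (rule rank_diff_ge) (use u v le jump le_i in auto)
    moreover have "(\<Sum>i\<in>I. if i \<in> T - Z then 2 else 0) = 2 * card (T - Z)"
    proof -
      have "I \<inter> (T - Z) = T - Z" using TI by blast
      then show ?thesis by (simp add: sum.If_cases[OF finite_atLeastAtMost] Collect_mem_eq del: Diff_iff)
    qed
    \<comment> \<open>\<open>rank_lt\<close> is what gives the extra 1 when \<open>T - Z\<close> is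
      empty, where \<open>2 * card (T - Z) - 1\<close> is truncated to 0.\<close>
    ultimately show ?thesis using c rank_lt by linarith
  next
    case False
    then obtain r y where r: "r \<in> Z" and y: "y \<in> I - T" and ZT: "Z \<subseteq> T" using TI by blast
    have u_ne: "u \<noteq> E {}" using False by (auto simp: Z_def supp_E)
    have v_ne: "v \<noteq> E I" using False by (auto simp: T_def tops_E)
    have u_ne': "u \<noteq> E I" using less le_E_I[OF v(1)] by auto
    have v_ne': "v \<noteq> E {}" using less E_empty_le[OF u(1)] by auto
    \<comment> \<open>The laminar bound below is larger by 2, and regularity pays for it: the
      coordinate \<open>a\<close> in \<open>Z\<close> still rises to the top in \<open>v\<close>,
      and the coordinate \<open>b\<close> outside \<open>T\<close> leaves 0. Each adds 1 to the
      rank, outside \<open>T - Z\<close>.\<close>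
    obtain a where a: "a \<in> I" "0 < u a" "u a < L a" using regular_strict[OF u u_ne u_ne'] .
    obtain b where b: "b \<in> I" "0 < v b" "v b < L b" using regular_strict[OF v v_ne' v_ne] .
    have aZ: "a \<in> Z" using a by (simp add: Z_def supp_def)
    have va: "v a = L a" using aZ ZT by (auto simp: T_def tops_def)
    have bT: "b \<notin> T" using b by (simp add: T_def tops_def)
    have ub: "u b = 0" using bT ZT b(1) by (auto simp: Z_def supp_def)
    \<comment> \<open>With \<open>r\<close> in \<open>Z\<close> all sides miss \<open>Z\<close>, but
      a side may leave \<open>T\<close>, and then it contains all of \<open>I - T\<close>.
      Contracting \<open>I - T\<close> to its point \<open>y\<close> therefore loses no information
      and leaves a laminar family on \<open>card (T - Z) + 1\<close> points.\<close>
    define sd where "sd A = side r A \<inter> insert y (T - Z)" for A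
    have sideZ: "side r A \<inter> Z = {}" if "A \<in> Q" for A
      using QD(5)[OF that] r by (auto simp: side_def)
    have sideT: "side r A \<subseteq> T \<or> I - T \<subseteq> side r A" if "A \<in> Q" for A
      using QD(6)[OF that] QD(1)[OF that] by (auto simp: side_def)
    have side_sd: "side r A = (sd A - {y}) \<union> (if y \<in> sd A then I - T else {})" if "A \<in> Q" for A
      using sideT[OF that]
    proof
      assume "side r A \<subseteq> T"
      moreover from this have "y \<notin> sd A" using y by (auto simp: sd_def)
      ultimately show ?thesis using sideZ[OF that] y unfolding sd_def by auto
    next
      assume "I - T \<subseteq> side r A"
      moreover from this have "y \<in> sd A" using y by (auto simp: sd_def)
      ultimately show ?thesis using sideZ[OF that] y side_ne(3)[OF that, of r] ZT
        unfolding sd_def by auto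
    qed
    have "inj_on sd Q"
    proof (rule inj_onI)
      fix A B assume AB: "A \<in> Q" "B \<in> Q" "sd A = sd B"
      have "side r A = side r B"
        using side_sd[OF AB(1)] side_sd[OF AB(2)] AB(3) by simp
      then show "A = B" using side_inj AB unfolding inj_on_def by blast
    qed
    then have "card Q = card (sd ` Q)" by (simp add: card_image)
    also have "\<dots> \<le> 2 * card (insert y (T - Z)) - 1"
    proof (rule card_laminar_family_le)
      show "finite (insert y (T - Z))" using finT by simp
      show "sd ` Q \<subseteq> Pow (insert y (T - Z))" by (auto simp: sd_def)
      have "sd A \<noteq> {}" if "A \<in> Q" for A
        using side_sd[OF that] side_ne(1)[OF that, of r] by (metis Diff_empty empty_Diff empty_iff sup_bot_right)
      then show "{} \<notin> sd ` Q" by auto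
      show "A \<subseteq> B \<or> B \<subseteq> A \<or> A \<inter> B = {}" if AB: "A \<in> sd ` Q" "B \<in> sd ` Q" for A B
      proof -
        have rI: "r \<in> I" using r ZI by blast
        obtain A' B' where "A' \<in> Q" "B' \<in> Q" "A = sd A'" "B = sd B'" using AB by blast
        then show ?thesis using side_lam[OF rI \<open>A' \<in> Q\<close> \<open>B' \<in> Q\<close>] unfolding sd_def by blast
      qed
    qed
    also have "\<dots> = 2 * card (T - Z) + 1" using y finT by simp
    finally have c: "card Q \<le> 2 * card (T - Z) + 1" .
    let ?g = "\<lambda>i. (if i \<in> T - Z then 2 else 0) + ((if i = a then 1 else 0) + (if i = b then 1 else 0))"
    have "rank u + (\<Sum>i\<in>I. ?g i) \<le> rank v"
    proof (rule rank_diff_ge)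
      show "?g i + u i \<le> v i" if i: "i \<in> I" for i
        using jump[of i] le_i[OF i] a b va ub aZ bT by auto
    qed (use u v le in auto)
    moreover have "(\<Sum>i\<in>I. ?g i) = 2 * card (T - Z) + 2"
    proof -
      have "I \<inter> (T - Z) = T - Z" using TI by blast
      then have "(\<Sum>i\<in>I. if i \<in> T - Z then 2 else (0::nat)) = 2 * card (T - Z)"
        by (simp add: sum.If_cases[OF finite_atLeastAtMost] Collect_mem_eq del: Diff_iff)
      moreover have "(\<Sum>i\<in>I. if i = a then 1 else (0::nat)) = 1"
        "(\<Sum>i\<in>I. if i = b then 1 else (0::nat)) = 1" using a b by simp_all
      ultimately show ?thesis by (simp only: sum.distrib)
    qed
    ultimately show ?thesis using c by linarith
  qed
  then show ?thesis by (simp add: Q_def)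
qed

section \<open>The bound on sets of unresolved tuples\<close>

definition comparable :: "(nat \<Rightarrow> nat) \<Rightarrow> (nat \<Rightarrow> nat) \<Rightarrow> bool" where
  "comparable u v \<longleftrightarrow> u \<le> v \<or> v \<le> u"

text \<open>The one way in which a third vertex can resolve two vertices \<open>u\<close> and
  \<open>v\<close> at distance 2: \<open>E (I - A)\<close> is adjacent to \<open>v\<close> and at
  distance 3 from \<open>u = E A\<close>.\<close>

definition faces_complement :: "(nat \<Rightarrow> nat) \<Rightarrow> (nat \<Rightarrow> nat) \<Rightarrow> bool" where
  "faces_complement u v \<longleftrightarrow> (\<exists>A\<subseteq>I. u = E A \<and> comparable v (E (I - A)))"

text \<open>The hypotheses are what a resolving set imposes on its complement. The splits in
  \<open>S\<close> are charged to the steps of the chain of regular members, where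
  \<open>step_bound\<close> leaves 1 unit of rank per step for the chain itself.\<close>

theorem card_unresolved_le:
  assumes S: "S \<subseteq> tuples - {E {}, E I}"
    and no_compl: "\<And>A. A \<subseteq> I \<Longrightarrow> E A \<in> S \<Longrightarrow> E (I - A) \<notin> S"
    and pairs: "\<And>u v. u \<in> S \<Longrightarrow> v \<in> S \<Longrightarrow>
      comparable u v \<or> faces_complement u v \<or> faces_complement v u"
  shows "card S + 1 \<le> rank (E I)"
proof -
  define F where "F = {A. A \<subseteq> I \<and> E A \<in> S}"
  define S1 where "S1 = {u \<in> S. regular u}"
  \<comment> \<open>The added bottom is low and the added top is high for every split, so each split
    is crossed somewhere along \<open>C\<close>.\<close>
  define C where "C = insert (E {}) (insert (E I) S1)"
  have finS: "finite S" using S finite_tuples by (meson finite_Diff finite_subset)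
  have finS1: "finite S1" using finS by (simp add: S1_def)
  have finC: "finite C" using finS1 by (simp add: C_def)
  have finF: "finite F" by (rule finite_subset[of _ "Pow I"]) (auto simp: F_def)
  have Freg: "F \<subseteq> Pow I - {{}, I}" using S by (auto simp: F_def)
  have SE: "S = S1 \<union> E ` F" using S by (auto simp: S1_def F_def regular_def)
  have comp_E: "comparable u (E A) \<longleftrightarrow> supp u \<subseteq> A \<or> A \<subseteq> tops u" if "u \<in> tuples" "A \<subseteq> I" for u A
    using that by (simp add: comparable_def le_E_iff E_le_iff)
  \<comment> \<open>A regular \<open>u\<close> in \<open>S\<close> is not of the form
    \<open>E B\<close>, so in the pair of \<open>u\<close> and \<open>E A\<close> only
    \<open>E A\<close> can face its complement. Hence \<open>u\<close> is comparable to
    \<open>E A\<close> or to \<open>E (I - A)\<close>.\<close>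
  have lowhigh: "low A u \<or> high A u" if "u \<in> S1" "A \<in> F" for u A
  proof -
    have uS: "u \<in> S" "u \<in> tuples" "regular u" and A: "A \<subseteq> I" "E A \<in> S" "A \<noteq> {}" "A \<noteq> I"
      using that S Freg by (auto simp: S1_def F_def)
    have "\<not> faces_complement u (E A)"
    proof
      assume "faces_complement u (E A)"
      then obtain B where "B \<subseteq> I" "u = E B" unfolding faces_complement_def by blast
      moreover have "B \<noteq> {}" "B \<noteq> I" using \<open>u = E B\<close> uS(1) S by auto
      ultimately show False using uS(3) unfolding regular_def by blast
    qed
    then have "comparable u (E A) \<or> faces_complement (E A) u" using pairs[OF uS(1) A(2)] by blast
    then have "comparable u (E A) \<or> comparable u (E (I - A))"
      unfolding faces_complement_def using E_inj A(1) by auto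
    moreover have "supp u \<subseteq> I" by (auto simp: supp_def)
    ultimately show ?thesis using comp_E[OF uS(2)] A(1) by (auto simp: low_def high_def)
  qed
  have compEE: "comparable (E A) (E B) \<longleftrightarrow> A \<subseteq> B \<or> B \<subseteq> A" if "A \<subseteq> I" "B \<subseteq> I" for A B
    using comp_E[OF E_tuples that(2)] that by (simp add: supp_E tops_E)
  have cf: "cross_free F"
    unfolding cross_free_def
  proof (intro conjI ballI)
    show "I - A \<notin> F" if "A \<in> F" for A using that no_compl by (auto simp: F_def)
    fix A B assume "A \<in> F" "B \<in> F"
    then have AB: "A \<subseteq> I" "E A \<in> S" "B \<subseteq> I" "E B \<in> S" by (auto simp: F_def)
    \<comment> \<open>For two splits, facing the complement means that \<open>A\<close> and
      \<open>B\<close> are disjoint or cover \<open>I\<close>; comparability supplies the two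
      inclusions of cross-freeness.\<close>
    have "faces_complement (E A) (E B) \<longleftrightarrow> B \<subseteq> I - A \<or> I - A \<subseteq> B"
      if "A \<subseteq> I" "B \<subseteq> I" for A B
      using that compEE[OF that(2), of "I - A"] by (auto simp: faces_complement_def E_inj)
    then show "A \<subseteq> B \<or> B \<subseteq> A \<or> A \<inter> B = {} \<or> A \<union> B = I"
      using pairs[OF AB(2,4)] compEE[OF AB(1,3)] AB(1,3) by blast
  qed (rule Freg)
  have C_tuples: "C \<subseteq> tuples" using S by (auto simp: C_def S1_def E_tuples)
  have C_reg: "regular u" if "u \<in> C" for u
    using that by (auto simp: C_def S1_def regular_def E_inj)
  have C_chain: "u \<le> v \<or> v \<le> u" if "u \<in> C" "v \<in> C" for u v
  proof (cases "u \<in> S1 \<and> v \<in> S1")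
    case True
    then have "\<not> faces_complement u v" "\<not> faces_complement v u"
      using S by (auto simp: S1_def faces_complement_def regular_def)
    then show ?thesis using pairs[of u v] True by (auto simp: S1_def comparable_def)
  next
    case False
    then show ?thesis using that C_tuples E_empty_le le_E_I by (auto simp: C_def)
  qed
  have C_lowhigh: "low A u \<or> high A u" if "u \<in> C" "A \<in> F" for u A
  proof -
    have "low A (E {})" by (simp add: low_def supp_E)
    moreover have "high A (E I)" using that(2) by (simp add: high_def tops_E F_def)
    ultimately show ?thesis using that lowhigh by (auto simp: C_def)
  qed
  \<comment> \<open>Invariant along the chain: the rank of \<open>u\<close> pays for all splits that
    are already high at \<open>u\<close> and for all chain elements below \<open>u\<close>.\<close>
  have main: "card {A \<in> F. high A u} + card {w \<in> C. w < u} \<le> rank u" if "u \<in> C" for u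
    using that
  proof (induction "rank u" arbitrary: u rule: less_induct)
    case less
    show ?case
    proof (cases "u = E {}")
      case True
      have "{A \<in> F. high A u} = {}" using Freg by (auto simp: True high_def tops_E)
      moreover have "{w \<in> C. w < u} = {}" using True E_empty_le C_tuples leD by blast
      ultimately show ?thesis by (simp only: card.empty)
    next
      case False
      define D where "D = {w \<in> C. w < u}"
      have D0: "E {} \<in> D" using False E_empty_le[of u] less.prems C_tuples
        by (auto simp: D_def C_def)
      have finD: "finite D" using finC by (simp add: D_def)
      \<comment> \<open>\<open>w\<close> is the immediate predecessor of \<open>u\<close> in the
        chain: a maximal element of the finite set \<open>D\<close>, and the greatest one since
        \<open>C\<close> is a chain.\<close>
      obtain w where w: "w \<in> D" "\<And>x. x \<in> D \<Longrightarrow> x \<le> w"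
      proof -
        have "\<exists>w\<in>D. \<forall>x\<in>D. w \<le> x \<longrightarrow> w = x" using finite_has_maximal[OF finD] D0 by blast
        then show thesis using that C_chain unfolding D_def by (metis (mono_tags, lifting) mem_Collect_eq)
      qed
      have wC: "w \<in> C" "w < u" using w by (auto simp: D_def)
      have "D = insert w {x \<in> C. x < w}"
        using w wC by (fastforce simp: D_def)
      then have cD: "card D = Suc (card {x \<in> C. x < w})" using finC by simp
      have "rank w < rank u" using rank_strict_mono wC less.prems C_tuples by blast
      then have IH: "card {A \<in> F. high A w} + card {x \<in> C. x < w} \<le> rank w"
        using less.hyps wC by blast
      have "card {A \<in> F. low A w \<and> high A u} + 1 + rank w \<le> rank u"
        using step_bound[OF cf] wC less.prems C_tuples C_reg by blast
      \<comment> \<open>A split that is high at \<open>u\<close> but not at \<open>w\<close> is low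
        at \<open>w\<close>, so it is crossed in this very step and counted by
        \<open>step_bound\<close>.\<close>
      moreover have "{A \<in> F. high A u} \<subseteq> {A \<in> F. high A w} \<union> {A \<in> F. low A w \<and> high A u}"
        using C_lowhigh[OF wC(1)] by blast
      then have "card {A \<in> F. high A u} \<le> card ({A \<in> F. high A w} \<union> {A \<in> F. low A w \<and> high A u})"
        using finF by (intro card_mono) auto
      then have "card {A \<in> F. high A u} \<le> card {A \<in> F. high A w} + card {A \<in> F. low A w \<and> high A u}"
        using card_Un_le order_trans by blast
      ultimately show ?thesis using IH cD by (simp add: D_def)
    qed
  qed
  \<comment> \<open>The invariant is evaluated at the top: all splits are high there, and the
    bottom, which lies below together with \<open>S1\<close>, yields the \<open>+ 1\<close>.\<close>
  have "{A \<in> F. high A (E I)} = F" by (auto simp: high_def tops_E F_def)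
  moreover have "{w \<in> C. w < E I} = insert (E {}) S1"
  proof -
    have "E {} \<noteq> E I" using E_inj[of "{}" I] m_ge by auto
    moreover have "E I \<notin> S1" using S by (auto simp: S1_def)
    ultimately show ?thesis using C_tuples le_E_I by (auto simp: C_def less_le)
  qed
  moreover have "E {} \<notin> S1" using S by (auto simp: S1_def)
  moreover have "card S \<le> card S1 + card F"
    unfolding SE using card_Un_le[of S1 "E ` F"] card_image_le[OF finF, of E] by linarith
  ultimately show ?thesis using main[of "E I"] finS1 by (simp add: C_def)
qed

end

section \<open>Strong resolving sets\<close>

context wf_digraph
begin

lemma awalk_cost_1: "awalk_cost (\<lambda>_. 1) p = real (length p)"
  by (induction p) auto

lemma graph_dist_le_length: "awalk u p v \<Longrightarrow> graph_dist G u v \<le> ereal (length p)"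
  using min_cost_le_walk_cost[of u p v "\<lambda>_. 1"] by (simp add: graph_dist_def awalk_cost_1)

text \<open>The distance is an infimum over walks, so the bound also covers pairs without any walk,
  whose distance is infinite.\<close>

lemma le_graph_distI:
  assumes "\<And>p. awalk u p v \<Longrightarrow> k \<le> length p"
  shows "ereal (real k) \<le> graph_dist G u v"
  unfolding graph_dist_def \<mu>_def awalk_cost_1 by (rule INF_greatest) (use assms in auto)

lemma graph_dist_le_walk:
  "u \<rightarrow>\<^bsub>G\<^esub> v \<Longrightarrow> graph_dist G u v \<le> 1"
  "u \<rightarrow>\<^bsub>G\<^esub> w \<Longrightarrow> w \<rightarrow>\<^bsub>G\<^esub> v \<Longrightarrow> graph_dist G u v \<le> 2"
  "u \<rightarrow>\<^bsub>G\<^esub> w \<Longrightarrow> w \<rightarrow>\<^bsub>G\<^esub> x \<Longrightarrow> x \<rightarrow>\<^bsub>G\<^esub> v \<Longrightarrow> graph_dist G u v \<le> 3"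
proof -
  have arc: "\<exists>e. awalk u [e] v" if "u \<rightarrow>\<^bsub>G\<^esub> v" for u v
    using that by (auto simp: arcs_ends_conv awalk_Cons_iff awalk_Nil_iff)
  show "graph_dist G u v \<le> 1" if uv: "u \<rightarrow>\<^bsub>G\<^esub> v"
  proof -
    obtain e where "awalk u [e] v" using arc[OF uv] by blast
    from graph_dist_le_length[OF this] show ?thesis by (simp add: one_ereal_def)
  qed
  show "graph_dist G u v \<le> 2" if uw: "u \<rightarrow>\<^bsub>G\<^esub> w" and wv: "w \<rightarrow>\<^bsub>G\<^esub> v"
  proof -
    obtain e f where "awalk u [e] w" "awalk w [f] v" using arc[OF uw] arc[OF wv] by blast
    then have "awalk u ([e] @ [f]) v" by (rule awalk_appendI)
    from graph_dist_le_length[OF this] show ?thesis by simp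
  qed
  show "graph_dist G u v \<le> 3" if uw: "u \<rightarrow>\<^bsub>G\<^esub> w" and wx: "w \<rightarrow>\<^bsub>G\<^esub> x" and xv: "x \<rightarrow>\<^bsub>G\<^esub> v"
  proof -
    obtain e f g where "awalk u [e] w" "awalk w [f] x" "awalk x [g] v"
      using arc[OF uw] arc[OF wx] arc[OF xv] by blast
    then have "awalk u ([e] @ [f] @ [g]) v" by (blast intro: awalk_appendI)
    from graph_dist_le_length[OF this] show ?thesis by simp
  qed
qed

lemma graph_dist_nonneg: "0 \<le> graph_dist G u v"
  using le_graph_distI[of u v 0] by (simp add: zero_ereal_def)

lemma graph_dist_self: "u \<in> verts G \<Longrightarrow> graph_dist G u u = 0"
  using graph_dist_le_length[of u "[]" u] graph_dist_nonneg[of u u]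
  by (simp add: awalk_Nil_iff zero_ereal_def)

text \<open>Walks of length 0, 1 and 2 are excluded in turn: they would give equal ends, an arc, or
  a common neighbour.\<close>

lemma graph_dist_ge:
  "u \<noteq> v \<Longrightarrow> 1 \<le> graph_dist G u v"
  "u \<noteq> v \<Longrightarrow> \<not> u \<rightarrow>\<^bsub>G\<^esub> v \<Longrightarrow> 2 \<le> graph_dist G u v"
  "u \<noteq> v \<Longrightarrow> \<not> u \<rightarrow>\<^bsub>G\<^esub> v \<Longrightarrow> \<nexists>w. u \<rightarrow>\<^bsub>G\<^esub> w \<and> w \<rightarrow>\<^bsub>G\<^esub> v \<Longrightarrow> 3 \<le> graph_dist G u v"
proof -
  have l0: "length p \<noteq> 0" if "awalk u p v" "u \<noteq> v" for p
    using that by (auto simp: awalk_Nil_iff)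
  have l1: "length p \<noteq> 1" if "awalk u p v" "\<not> u \<rightarrow>\<^bsub>G\<^esub> v" for p
  proof
    assume "length p = 1"
    then obtain e where "p = [e]" by (auto simp: length_Suc_conv)
    then have "e \<in> arcs G" "u = tail G e" "head G e = v"
      using that(1) by (simp_all add: awalk_Cons_iff awalk_Nil_iff)
    then show False using that(2) unfolding arcs_ends_conv by blast
  qed
  have l2: "length p \<noteq> 2" if "awalk u p v" "\<nexists>w. u \<rightarrow>\<^bsub>G\<^esub> w \<and> w \<rightarrow>\<^bsub>G\<^esub> v" for p
  proof
    assume "length p = 2"
    then obtain e f where "p = [e, f]" by (auto simp: numeral_2_eq_2 length_Suc_conv)
    then have "e \<in> arcs G" "f \<in> arcs G" "u = tail G e" "head G e = tail G f" "head G f = v"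
      using that(1) by (simp_all add: awalk_Cons_iff awalk_Nil_iff)
    then have "u \<rightarrow>\<^bsub>G\<^esub> head G e" "head G e \<rightarrow>\<^bsub>G\<^esub> v"
      unfolding arcs_ends_conv by force+
    then show False using that(2) by blast
  qed
  show "1 \<le> graph_dist G u v" if "u \<noteq> v"
  proof -
    have "1 \<le> length p" if "awalk u p v" for p
      using l0[OF that \<open>u \<noteq> v\<close>] by linarith
    from le_graph_distI[OF this] show ?thesis by (simp add: one_ereal_def)
  qed
  show "2 \<le> graph_dist G u v" if nv: "u \<noteq> v" "\<not> u \<rightarrow>\<^bsub>G\<^esub> v"
  proof -
    have "2 \<le> length p" if "awalk u p v" for p
      using l0[OF that nv(1)] l1[OF that nv(2)] by linarith
    from le_graph_distI[OF this] show ?thesis by simp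
  qed
  show "3 \<le> graph_dist G u v" if nv: "u \<noteq> v" "\<not> u \<rightarrow>\<^bsub>G\<^esub> v" "\<nexists>w. u \<rightarrow>\<^bsub>G\<^esub> w \<and> w \<rightarrow>\<^bsub>G\<^esub> v"
  proof -
    have "3 \<le> length p" if "awalk u p v" for p
      using l0[OF that nv(1)] l1[OF that nv(2)] l2[OF that nv(3)] by linarith
    from le_graph_distI[OF this] show ?thesis by simp
  qed
qed

end

section \<open>Comparability of proper tuples\<close>

context chain_product
begin

definition proper :: "(nat \<Rightarrow> nat) set" where
  "proper = tuples - {E {}, E I}"

lemma E_proper_iff: "A \<subseteq> I \<Longrightarrow> E A \<in> proper \<longleftrightarrow> A \<noteq> {} \<and> A \<noteq> I"
  by (auto simp: proper_def E_tuples E_inj)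

lemma properI:
  assumes "u \<in> tuples" "i \<in> I" "0 < u i" "j \<in> I" "u j < L j"
  shows "u \<in> proper"
proof -
  have "u \<noteq> E {}" "u \<noteq> E I"
    using assms by (auto simp: E_nth)
  then show ?thesis using assms(1) by (simp add: proper_def)
qed

lemma proper_pos:
  assumes "u \<in> proper"
  obtains i where "i \<in> I" "0 < u i"
proof (rule ccontr)
  assume "\<not> thesis"
  then have "u = E {}" using assms that
    by (intro tuples_eqI) (auto simp: proper_def E_tuples E_nth)
  then show False using assms by (simp add: proper_def)
qed

lemma proper_less:
  assumes "u \<in> proper"
  obtains i where "i \<in> I" "u i < L i"
proof (rule ccontr)
  assume "\<not> thesis"
  then have "\<forall>i\<in>I. \<not> u i < L i" using that by blast
  moreover have ut: "u \<in> tuples" using assms by (simp add: proper_def)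
  ultimately have "u = E I" using tuples_le_L[OF ut]
    by (intro tuples_eqI E_tuples ut) (force simp: E_nth)
  then show False using assms by (simp add: proper_def)
qed

lemma restrict_tuples: "(\<And>i. i \<in> I \<Longrightarrow> f i \<le> L i) \<Longrightarrow> restrict f I \<in> tuples"
  by (auto simp: tuples_def)

text \<open>The meet \<open>w\<close> and the join \<open>x\<close> are comparable to both tuples.
  If neither is proper, the meet is bottom and the join is top, so in each coordinate one tuple is 0
  and the other is \<open>L i\<close>.\<close>

lemma incomparable_cases:
  assumes u: "u \<in> proper" and v: "v \<in> proper" and inc: "\<not> comparable u v"
  obtains (nbr) w where "w \<in> proper" "w \<noteq> u" "w \<noteq> v" "comparable u w" "comparable w v"
    | (compl) A where "A \<subseteq> I" "u = E A" "v = E (I - A)"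
proof -
  have ut: "u \<in> tuples" and vt: "v \<in> tuples" using u v by (auto simp: proper_def)
  define w where "w = (\<lambda>i\<in>I. min (u i) (v i))"
  define x where "x = (\<lambda>i\<in>I. max (u i) (v i))"
  have wt: "w \<in> tuples" unfolding w_def
    by (rule restrict_tuples) (use tuples_le_L[OF ut] min.coboundedI1 in blast)
  have xt: "x \<in> tuples" unfolding x_def
    by (rule restrict_tuples) (use tuples_le_L[OF ut] tuples_le_L[OF vt] in simp)
  have w: "w \<le> u" "w \<le> v" using wt ut vt by (auto simp: tuples_le_iff w_def)
  have x: "u \<le> x" "v \<le> x" using xt ut vt by (auto simp: tuples_le_iff x_def)
  have ne: "w \<noteq> u" "w \<noteq> v" "x \<noteq> u" "x \<noteq> v" using inc w x by (auto simp: comparable_def)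
  consider "w \<in> proper" | "x \<in> proper" | "w \<notin> proper" "x \<notin> proper" by blast
  then show thesis
  proof cases
    case 1 then show thesis using nbr ne w by (auto simp: comparable_def)
  next
    case 2 then show thesis using nbr ne x by (auto simp: comparable_def)
  next
    case 3
    have "w \<noteq> E I" using w le_E_I[OF ut] ne by auto
    then have w0: "w = E {}" using 3 wt by (auto simp: proper_def)
    have "x \<noteq> E {}" using x E_empty_le[OF ut] ne by auto
    then have x1: "x = E I" using 3 xt by (auto simp: proper_def)
    have mm: "min (u i) (v i) = 0" "max (u i) (v i) = L i" if "i \<in> I" for i
      using that fun_cong[OF w0, of i] fun_cong[OF x1, of i] by (auto simp: w_def x_def E_nth)
    define A where "A = {i \<in> I. u i = L i}"
    have "u i = (if i \<in> A then L i else 0)" "v i = (if i \<in> I - A then L i else 0)" if "i \<in> I" for i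
      using mm[OF that] that L_pos[OF that] by (auto simp: A_def min_def max_def split: if_splits)
    then have "u = E A" "v = E (I - A)"
      by (auto intro!: tuples_eqI ut vt E_tuples simp: E_nth)
    moreover have "A \<subseteq> I" by (auto simp: A_def)
    ultimately show thesis using compl by blast
  qed
qed

text \<open>The path descends from \<open>E A\<close> to an atom \<open>w\<close> at some
  \<open>a\<close> in \<open>A\<close>, climbs to the join \<open>x\<close> of \<open>w\<close> and
  \<open>E (I - A)\<close>, and descends to \<open>E (I - A)\<close>. As \<open>L a > 1\<close>,
  \<open>w\<close> differs from \<open>E A\<close> and \<open>x\<close> from the top even if
  \<open>A = {a}\<close>.\<close>

lemma complement_path:
  assumes A: "A \<subseteq> I" "A \<noteq> {}" "A \<noteq> I"
  obtains w x where "w \<in> proper" "x \<in> proper" "w \<noteq> E A" "comparable (E A) w"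
    "w \<noteq> x" "comparable w x" "x \<noteq> E (I - A)" "comparable x (E (I - A))"
proof -
  obtain a where a: "a \<in> A" using A by blast
  obtain b where b: "b \<in> I - A" using A by blast
  have aI: "a \<in> I" using a A by blast
  have La: "1 < L a" "1 \<le> L a" using L_ge[OF aI] by auto
  define w where "w = (\<lambda>i\<in>I. if i = a then 1 else 0 :: nat)"
  define x where "x = (\<lambda>i\<in>I. if i = a then 1 else if i \<in> A then 0 else L i)"
  have wt: "w \<in> tuples" unfolding w_def by (rule restrict_tuples) (use La in auto)
  have xt: "x \<in> tuples" unfolding x_def by (rule restrict_tuples) (use La in auto)
  have wa: "w a = 1" and xa: "x a = 1" using aI by (auto simp: w_def x_def)
  have wb: "w b = 0" and xb: "x b = L b" using b a by (auto simp: w_def x_def)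
  have wp: "w \<in> proper" by (rule properI[OF wt aI _ aI]) (use La wa in auto)
  have xp: "x \<in> proper" by (rule properI[OF xt aI _ aI]) (use La xa in auto)
  have "w \<noteq> E A" using wa a aI La fun_cong[of w "E A" a] by (auto simp: E_nth)
  moreover have "x \<noteq> E (I - A)" using xa a aI La fun_cong[of x "E (I - A)" a] by (auto simp: E_nth)
  moreover have "w \<noteq> x" using wb xb L_pos[of b] b by auto
  moreover have "w \<le> E A" using a La unfolding tuples_le_iff[OF wt E_tuples] by (auto simp: E_nth w_def)
  moreover have "E (I - A) \<le> x" using a unfolding tuples_le_iff[OF E_tuples xt] by (auto simp: E_nth x_def)
  moreover have "w \<le> x" unfolding tuples_le_iff[OF wt xt] by (auto simp: w_def x_def)
  ultimately show thesis using that wp xp by (auto simp: comparable_def)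
qed

text \<open>A proper tuple is neither below both (their meet is bottom) nor above both (their join
  is top), and it cannot lie between them since they are incomparable.\<close>

lemma complement_no_common_neighbour:
  assumes A: "A \<subseteq> I" "A \<noteq> {}" "A \<noteq> I" and c: "c \<in> proper"
    "comparable (E A) c" "comparable c (E (I - A))"
  shows False
proof -
  have ct: "c \<in> tuples" using c by (simp add: proper_def)
  have "supp c \<subseteq> A \<or> A \<subseteq> tops c" "supp c \<subseteq> I - A \<or> I - A \<subseteq> tops c"
    using c le_E_iff[OF ct] E_le_iff[OF ct] A by (auto simp: comparable_def)
  moreover have "tops c \<subseteq> supp c" using L_pos by (auto simp: tops_def supp_def)
  moreover obtain i where "i \<in> I" "0 < c i" using proper_pos[OF c(1)] .
  then have "i \<in> supp c" by (simp add: supp_def)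
  moreover obtain j where "j \<in> I" "c j < L j" using proper_less[OF c(1)] .
  then have "j \<in> I" "j \<notin> tops c" by (simp_all add: tops_def)
  ultimately show False using A by blast
qed

text \<open>Such a \<open>w\<close> has distance 1 to one of the two vertices and 2 to the other,
  and so resolves this adjacent pair.\<close>

lemma less_distinguished:
  assumes u: "u \<in> proper" and v: "v \<in> proper" and less: "u < v"
  obtains w where "w \<in> proper" "\<not> comparable w u" "comparable w v"
    | w where "w \<in> proper" "\<not> comparable w v" "comparable w u"
proof -
  have ut: "u \<in> tuples" and vt: "v \<in> tuples" using u v by (auto simp: proper_def)
  have le: "\<And>i. i \<in> I \<Longrightarrow> u i \<le> v i" using less by (simp add: less_imp_le le_funD)
  have "\<not> v \<le> u" using less by auto
  then obtain i where i: "i \<in> I" "u i < v i"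
    using tuples_le_iff[OF vt ut] by (meson not_le_imp_less)
  obtain j where j: "j \<in> I" "j \<noteq> i"
  proof -
    have "1 \<in> I" "2 \<in> I" using m_ge by auto
    then show thesis using that by (metis one_eq_numeral_iff semiring_norm(85))
  qed
  \<comment> \<open>If \<open>u\<close> is nonzero at another coordinate, \<open>v i\<close> alone
    is below \<open>v\<close> and incomparable to \<open>u\<close>; the second case is its dual.
    Otherwise, away from \<open>i\<close>, \<open>u\<close> is 0 and \<open>v\<close> is at the top,
    and the tuple that is 0 at \<open>i\<close> and top elsewhere works.\<close>
  consider "\<exists>k\<in>I. k \<noteq> i \<and> 0 < u k" | "\<exists>k\<in>I. k \<noteq> i \<and> v k < L k"
    | "\<forall>k\<in>I. k \<noteq> i \<longrightarrow> u k = 0 \<and> v k = L k"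
    using tuples_le_L[OF vt] by (meson bot_nat_0.not_eq_extremum le_neq_implies_less)
  then show thesis
  proof cases
    case 1
    then obtain k where k: "k \<in> I" "k \<noteq> i" "0 < u k" by blast
    define w where "w = (\<lambda>l\<in>I. if l = i then v i else 0)"
    have wt: "w \<in> tuples" unfolding w_def
      by (rule restrict_tuples) (use tuples_le_L[OF vt] in auto)
    have "w \<in> proper" by (rule properI[OF wt i(1) _ k(1)]) (use i k L_pos in \<open>auto simp: w_def\<close>)
    moreover have "\<not> comparable w u"
      unfolding comparable_def tuples_le_iff[OF wt ut] tuples_le_iff[OF ut wt] using i k by (force simp: w_def)
    moreover have "w \<le> v" unfolding tuples_le_iff[OF wt vt] by (auto simp: w_def)
    ultimately show thesis using that(1) by (auto simp: comparable_def)
  next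
    case 2
    then obtain k where k: "k \<in> I" "k \<noteq> i" "v k < L k" by blast
    define w where "w = (\<lambda>l\<in>I. if l = i then u i else L l)"
    have wt: "w \<in> tuples" unfolding w_def
      by (rule restrict_tuples) (use tuples_le_L[OF ut] in auto)
    have "w \<in> proper" by (rule properI[OF wt k(1) _ i(1)])
        (use i k tuples_le_L[OF vt i(1)] in \<open>auto simp: w_def\<close>)
    moreover have "\<not> comparable w v"
      unfolding comparable_def tuples_le_iff[OF wt vt] tuples_le_iff[OF vt wt] using i k by (force simp: w_def)
    moreover have "u \<le> w" using tuples_le_L[OF ut] unfolding tuples_le_iff[OF ut wt] by (auto simp: w_def)
    ultimately show thesis using that(2) by (auto simp: comparable_def)
  next
    case 3
    obtain k where k: "k \<in> I" "0 < u k" using proper_pos[OF u] .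
    then have ui: "0 < u i" using 3 by force
    define w where "w = (\<lambda>l\<in>I. if l = i then 0 else L l)"
    have wt: "w \<in> tuples" unfolding w_def by (rule restrict_tuples) auto
    have "w \<in> proper" by (rule properI[OF wt j(1) _ i(1)])
        (use i j L_pos in \<open>auto simp: w_def\<close>)
    moreover have "\<not> comparable w u"
      unfolding comparable_def tuples_le_iff[OF wt ut] tuples_le_iff[OF ut wt]
      using i(1) j 3 ui L_pos[OF j(1)] by (force simp: w_def)
    moreover have "w \<le> v" using 3 unfolding tuples_le_iff[OF wt vt] by (auto simp: w_def)
    ultimately show thesis using that(1) by (auto simp: comparable_def)
  qed
qed

text \<open>An amount \<open>k\<close> is poured into the coordinates from 1 upwards, each up to its
  capacity \<open>L i\<close>. Truncated subtraction leaves 0 where nothing arrives. Increasing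
  \<open>k\<close> traverses a maximal chain.\<close>

definition fill :: "nat \<Rightarrow> nat \<Rightarrow> nat" where
  "fill k = (\<lambda>i\<in>I. min (L i) (k - (\<Sum>j\<in>{1..<i}. L j)))"

lemma fill_tuples: "fill k \<in> tuples"
  unfolding fill_def by (rule restrict_tuples) simp

lemma fill_mono: "k \<le> l \<Longrightarrow> fill k \<le> fill l"
  by (auto simp: tuples_le_iff fill_tuples) (auto simp: fill_def intro!: min.mono)

lemma rank_E_I: "rank (E I) = (\<Sum>i\<in>I. L i)"
  by (simp add: rank_def E_nth)

lemma rank_fill:
  assumes "k \<le> rank (E I)"
  shows "rank (fill k) = k"
proof -
  \<comment> \<open>Generalised to the first \<open>n\<close> coordinates, which absorb all of
    \<open>k\<close> or are full.\<close>
  have "(\<Sum>i\<in>{1..n}. min (L i) (k - (\<Sum>j\<in>{1..<i}. L j))) = min k (\<Sum>i\<in>{1..n}. L i)" for n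
  proof (induction n)
    case (Suc n)
    have "{1..<Suc n} = {1..n}" by auto
    then have "(\<Sum>i\<in>{1..Suc n}. min (L i) (k - (\<Sum>j\<in>{1..<i}. L j))) =
        min k (\<Sum>i\<in>{1..n}. L i) + min (L (Suc n)) (k - (\<Sum>i\<in>{1..n}. L i))"
      using Suc by simp
    also have "\<dots> = min k ((\<Sum>i\<in>{1..n}. L i) + L (Suc n))" by linarith
    finally show ?case by simp
  qed simp
  then show ?thesis using assms unfolding rank_E_I by (simp add: rank_def fill_def)
qed

lemma exists_max_chain:
  obtains C where "C \<subseteq> proper" "\<And>u v. u \<in> C \<Longrightarrow> v \<in> C \<Longrightarrow> comparable u v" "card C + 1 = rank (E I)"
proof
  \<comment> \<open>The amounts 0 and \<open>rank (E I)\<close> are left out, as they give bottom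
    and top. Injectivity holds because \<open>rank\<close> recovers the amount.\<close>
  let ?C = "fill ` {1..<rank (E I)}"
  show "?C \<subseteq> proper"
  proof
    fix u assume "u \<in> ?C"
    then obtain k where k: "u = fill k" "1 \<le> k" "k < rank (E I)" by auto
    then have "rank u = k" using rank_fill by simp
    then have "u \<noteq> E {}" "u \<noteq> E I" using k by (auto simp: rank_def E_nth)
    then show "u \<in> proper" using k fill_tuples by (simp add: proper_def)
  qed
  show "comparable u v" if "u \<in> ?C" "v \<in> ?C" for u v
    using that fill_mono by (auto simp: comparable_def) (metis nat_le_linear)
  have "inj_on fill {1..<rank (E I)}"
    by (rule inj_on_inverseI[of _ rank]) (simp add: rank_fill)
  moreover have "0 < rank (E I)"
    unfolding rank_E_I using m_ge L_pos by (intro sum_pos) auto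
  ultimately show "card ?C + 1 = rank (E I)" by (simp add: card_image)
qed

lemma card_tuples: "card tuples = (\<Prod>i\<in>I. L i + 1)"
  by (simp add: tuples_def card_PiE)

lemma card_proper: "card proper + 2 = card tuples"
proof -
  have "E {} \<noteq> E I" using E_inj[of "{}" I] m_ge by auto
  then have "card {E {}, E I} = 2" by simp
  moreover have "{E {}, E I} \<subseteq> tuples" by (simp add: E_tuples)
  ultimately show ?thesis unfolding proper_def
    using card_Diff_subset[of "{E {}, E I}" tuples] card_mono[OF finite_tuples, of "{E {}, E I}"] by simp
qed

lemma finite_proper: "finite proper"
  by (simp add: proper_def finite_tuples)

end

section \<open>Resolving sets in the comparability graph of proper tuples\<close>

locale chain_product_graph = chain_product m L + wf_digraph G
  for m L and G :: "('v, 'e) pre_digraph" +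
  fixes h :: "'v \<Rightarrow> nat \<Rightarrow> nat"
  assumes bij: "bij_betw h (verts G) proper"
    and adj: "\<And>a b. a \<in> verts G \<Longrightarrow> b \<in> verts G \<Longrightarrow>
      a \<rightarrow>\<^bsub>G\<^esub> b \<longleftrightarrow> a \<noteq> b \<and> comparable (h a) (h b)"
begin

abbreviation "d \<equiv> graph_dist G"

lemma h_proper: "a \<in> verts G \<Longrightarrow> h a \<in> proper"
  using bij by (rule bij_betwE[rule_format])

lemma h_inj: "a \<in> verts G \<Longrightarrow> b \<in> verts G \<Longrightarrow> h a = h b \<longleftrightarrow> a = b"
  using bij by (auto simp: bij_betw_def inj_on_def)

lemma h_surj:
  assumes "u \<in> proper"
  obtains a where "a \<in> verts G" "h a = u"
  by (metis assms bij bij_betw_imp_surj_on imageE that)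

lemma comparable_sym: "comparable u v \<longleftrightarrow> comparable v u"
  by (auto simp: comparable_def)

lemma incomparable_ne: "\<not> comparable (h a) (h b) \<Longrightarrow> a \<noteq> b"
  by (auto simp: comparable_def)

text \<open>A meet or join that is proper is a common neighbour. For complementary tuples none
  exists, and \<open>complement_path\<close> is a shortest path.\<close>

lemma dist_incomparable:
  assumes a: "a \<in> verts G" and b: "b \<in> verts G" and inc: "\<not> comparable (h a) (h b)"
  shows "d a b = 2 \<or> (d a b = 3 \<and> (\<exists>A\<subseteq>I. h a = E A \<and> h b = E (I - A)))"
  using h_proper[OF a] h_proper[OF b] inc
proof (cases rule: incomparable_cases)
  case (nbr w)
  then obtain c where c: "c \<in> verts G" "h c = w" using h_surj by blast
  have "a \<rightarrow>\<^bsub>G\<^esub> c" "c \<rightarrow>\<^bsub>G\<^esub> b" using nbr c a b adj by auto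
  then have "d a b \<le> 2" by (rule graph_dist_le_walk)
  moreover have "2 \<le> d a b" using graph_dist_ge(2) incomparable_ne[OF inc] adj a b inc by blast
  ultimately show ?thesis by auto
next
  case (compl A)
  have A: "A \<noteq> {}" "A \<noteq> I" using compl h_proper[OF a] E_proper_iff by auto
  obtain w x where wx: "w \<in> proper" "x \<in> proper" "w \<noteq> E A" "comparable (E A) w"
    "w \<noteq> x" "comparable w x" "x \<noteq> E (I - A)" "comparable x (E (I - A))"
    using complement_path[OF compl(1) A] .
  obtain p q where pq: "p \<in> verts G" "h p = w" "q \<in> verts G" "h q = x" using h_surj wx by metis
  have "a \<rightarrow>\<^bsub>G\<^esub> p" "p \<rightarrow>\<^bsub>G\<^esub> q" "q \<rightarrow>\<^bsub>G\<^esub> b" using pq wx a b adj compl by auto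
  then have "d a b \<le> 3" by (rule graph_dist_le_walk)
  moreover have "3 \<le> d a b"
  proof (rule graph_dist_ge(3))
    show "\<nexists>w. a \<rightarrow>\<^bsub>G\<^esub> w \<and> w \<rightarrow>\<^bsub>G\<^esub> b"
    proof
      assume "\<exists>w. a \<rightarrow>\<^bsub>G\<^esub> w \<and> w \<rightarrow>\<^bsub>G\<^esub> b"
      then obtain c where c: "a \<rightarrow>\<^bsub>G\<^esub> c" "c \<rightarrow>\<^bsub>G\<^esub> b" by blast
      then have cv: "c \<in> verts G" by (meson adj_in_verts(1))
      have "comparable (h a) (h c)" "comparable (h c) (h b)"
        using c cv adj a b by blast+
      then show False
        using complement_no_common_neighbour[OF compl(1) A h_proper[OF cv]] compl by simp
    qed
  qed (use incomparable_ne[OF inc] adj a b inc in blast)+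
  ultimately show ?thesis using compl by auto
qed

lemma dist_adjacent:
  assumes "a \<in> verts G" "b \<in> verts G" "a \<noteq> b" "comparable (h a) (h b)"
  shows "d a b = 1"
  using assms graph_dist_le_walk(1)[of a b] graph_dist_ge(1)[of a b] adj by auto

lemma dist_cases:
  assumes "a \<in> verts G" "b \<in> verts G"
  shows "a = b \<and> d a b = 0 \<or> a \<noteq> b \<and> comparable (h a) (h b) \<and> d a b = 1 \<or>
    \<not> comparable (h a) (h b) \<and> d a b = 2 \<or>
    \<not> comparable (h a) (h b) \<and> d a b = 3 \<and> (\<exists>A\<subseteq>I. h a = E A \<and> h b = E (I - A))"
  using assms dist_adjacent dist_incomparable graph_dist_self by blast

text \<open>Since all distances are at most 3, a geodesic can only be prolonged beyond a pair at
  distance 2 to a complementary pair.\<close>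

lemma resolved_incomparable:
  assumes v: "a \<in> verts G" "b \<in> verts G" "w \<in> verts G"
    and inc: "\<not> comparable (h a) (h b)" and "w \<noteq> b" and eq: "d w a = d w b + d b a"
  shows "d b a = 2 \<and> faces_complement (h a) (h b)"
proof -
  have inc': "\<not> comparable (h b) (h a)" using inc comparable_sym by blast
  have ba: "d b a = 2 \<or> d b a = 3" using dist_incomparable[OF v(2,1) inc'] by blast
  have wb: "d w b = 1 \<and> comparable (h w) (h b) \<or> d w b = 2 \<or> d w b = 3"
    using dist_cases[OF v(3,2)] \<open>w \<noteq> b\<close> by blast
  have wa: "d w a = 0 \<or> d w a = 1 \<or> d w a = 2 \<or> d w a = 3 \<and> (\<exists>A\<subseteq>I. h w = E A \<and> h a = E (I - A))"
    using dist_cases[OF v(3,1)] by blast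
  have e: "(1::ereal) = ereal 1" "(2::ereal) = ereal 2" "(3::ereal) = ereal 3" "(0::ereal) = ereal 0"
    by (simp_all add: one_ereal_def zero_ereal_def)
  \<comment> \<open>Here \<open>d b a\<close> is at least 2, \<open>d w b\<close> at least 1 as
    \<open>w\<close> differs from \<open>b\<close>, and \<open>d w a\<close> at most 3. The equation
    can only read 3 = 1 + 2, and distance 3 makes \<open>w\<close> and \<open>a\<close>
    complementary.\<close>
  have *: "d b a = 2 \<and> comparable (h w) (h b) \<and> (\<exists>A\<subseteq>I. h w = E A \<and> h a = E (I - A))"
    using ba wb wa eq unfolding e by (elim disjE conjE) simp_all
  then obtain A where A: "A \<subseteq> I" "h w = E A" "h a = E (I - A)" by blast
  have "I - (I - A) = A" using A by blast
  then have "faces_complement (h a) (h b)"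
    unfolding faces_complement_def using A * comparable_sym by (metis Diff_subset)
  then show ?thesis using * by blast
qed

text \<open>A vertex of \<open>W\<close> resolving two incomparable vertices outside
  \<open>W\<close> differs from both, so \<open>resolved_incomparable\<close> applies in one
  direction or the other and \<open>card_unresolved_le\<close> bounds the image of the
  complement.\<close>

lemma card_unresolved:
  assumes W: "strong_resolving_set G W"
  shows "card (verts G - W) + 1 \<le> rank (E I)"
proof -
  have WV: "W \<subseteq> verts G" using W by (simp add: strong_resolving_set_def)
  have res: "faces_complement (h a) (h b) \<and> d b a = 2 \<or> faces_complement (h b) (h a) \<and> d a b = 2"
    if ab: "a \<in> verts G - W" "b \<in> verts G - W" "\<not> comparable (h a) (h b)" for a b
  proof -
    have "a \<noteq> b" using ab(3) by (rule incomparable_ne)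
    then obtain w where w: "w \<in> W" "strongly_resolves G w a b"
      using W ab unfolding strong_resolving_set_def by blast
    have wv: "w \<in> verts G" "w \<noteq> a" "w \<noteq> b" using w WV ab by auto
    have "\<not> comparable (h b) (h a)" using ab(3) comparable_sym by blast
    then show ?thesis
      using w(2) resolved_incomparable[of a b w] resolved_incomparable[of b a w] ab wv
      unfolding strongly_resolves_def by blast
  qed
  let ?S = "h ` (verts G - W)"
  have "card ?S + 1 \<le> rank (E I)"
  proof (rule card_unresolved_le)
    show "?S \<subseteq> tuples - {E {}, E I}" unfolding proper_def[symmetric] using h_proper by auto
    show "E (I - A) \<notin> ?S" if A: "A \<subseteq> I" "E A \<in> ?S" for A
    proof
      assume "E (I - A) \<in> ?S"
      then obtain a b where ab: "a \<in> verts G - W" "b \<in> verts G - W" "h a = E A" "h b = E (I - A)"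
        using A by (metis imageE)
      have A': "A \<noteq> {}" "A \<noteq> I" using ab h_proper[of a] E_proper_iff[OF A(1)] by auto
      have inc: "\<not> comparable (h a) (h b)"
        unfolding ab comparable_def using A A'
        by (auto simp: le_E_iff E_tuples supp_E)
      have inc': "\<not> comparable (h b) (h a)" using inc comparable_sym by blast
      \<comment> \<open>Complementary vertices have no common neighbour, whereas \<open>res\<close>
        would put them at distance 2. So one of them must belong to \<open>W\<close>.\<close>
      have no2: "d x y \<noteq> 2" if "h x = E B" "h y = E (I - B)" "B \<subseteq> I" "B \<noteq> {}" "B \<noteq> I"
        "x \<in> verts G" "y \<in> verts G" "\<not> comparable (h x) (h y)" for x y B
      proof -
        have "\<nexists>c. x \<rightarrow>\<^bsub>G\<^esub> c \<and> c \<rightarrow>\<^bsub>G\<^esub> y"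
        proof
          assume "\<exists>c. x \<rightarrow>\<^bsub>G\<^esub> c \<and> c \<rightarrow>\<^bsub>G\<^esub> y"
          then obtain c where c: "x \<rightarrow>\<^bsub>G\<^esub> c" "c \<rightarrow>\<^bsub>G\<^esub> y" by blast
          then have cv: "c \<in> verts G" by (meson adj_in_verts(1))
          have "comparable (h x) (h c)" "comparable (h c) (h y)"
            using c cv adj that by blast+
          then show False
            using complement_no_common_neighbour[OF that(3,4,5) h_proper[OF cv]] that by simp
        qed
        moreover have "x \<noteq> y" "\<not> x \<rightarrow>\<^bsub>G\<^esub> y" using that adj incomparable_ne by blast+
        ultimately have "3 \<le> d x y" by (intro graph_dist_ge(3))
        then show ?thesis by auto
      qed
      have "I - (I - A) = A" "I - A \<noteq> {}" "I - A \<noteq> I" using A A' by blast+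
      then have "d a b \<noteq> 2" "d b a \<noteq> 2"
        using no2[OF ab(3,4) A(1) A'] no2[of b "I - A" a] ab inc inc' by auto
      then show False using res[OF ab(1,2) inc] by blast
    qed
    show "comparable u v \<or> faces_complement u v \<or> faces_complement v u"
      if "u \<in> ?S" "v \<in> ?S" for u v
      using that res by blast
  qed
  moreover have "card ?S = card (verts G - W)"
    using bij by (intro card_image) (auto simp: bij_betw_def intro: inj_on_subset)
  ultimately show ?thesis by simp
qed

lemma finite_verts: "finite (verts G)"
  using bij finite_proper bij_betw_finite by blast

text \<open>A pair with a member in the set is resolved by that member. Two vertices of the chain
  are resolved by the vertex from \<open>less_distinguished\<close>, which is incomparable to a
  chain element and hence not in the chain.\<close>

lemma chain_complement_resolving:
  assumes C: "\<And>u v. u \<in> C \<Longrightarrow> v \<in> C \<Longrightarrow> comparable u v"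
  shows "strong_resolving_set G {a \<in> verts G. h a \<notin> C}"
  unfolding strong_resolving_set_def
proof (intro conjI ballI impI)
  let ?W = "{a \<in> verts G. h a \<notin> C}"
  have self: "strongly_resolves G a a b" "strongly_resolves G b a b"
    if "a \<in> verts G" "b \<in> verts G" for a b
    using that by (simp_all add: strongly_resolves_def graph_dist_self)
  \<comment> \<open>\<open>b\<close> is a common neighbour of \<open>w\<close> and \<open>a\<close>,
    which are not adjacent, so \<open>b\<close> lies on a geodesic of length 2 between them.\<close>
  have far: "strongly_resolves G w a b \<and> strongly_resolves G w b a"
    if v: "a \<in> verts G" "b \<in> verts G" "w \<in> verts G" and ab: "a \<noteq> b" "comparable (h a) (h b)"
      and w: "\<not> comparable (h w) (h a)" "comparable (h w) (h b)" for a b w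
  proof -
    have "w \<noteq> b" using w ab comparable_sym by auto
    then have wb: "d w b = 1" using w v by (intro dist_adjacent)
    have ba: "d b a = 1" using v ab comparable_sym by (intro dist_adjacent) auto
    have "w \<rightarrow>\<^bsub>G\<^esub> b" "b \<rightarrow>\<^bsub>G\<^esub> a" using v w ab \<open>w \<noteq> b\<close> adj comparable_sym by auto
    then have "d w a \<le> 2" by (rule graph_dist_le_walk)
    moreover have "2 \<le> d w a" using dist_incomparable[OF v(3,1) w(1)] by auto
    ultimately have "d w a = d w b + d b a" using wb ba by (simp add: one_ereal_def numeral_eq_ereal)
    then show ?thesis by (simp add: strongly_resolves_def)
  qed
  fix a b assume a: "a \<in> verts G" and b: "b \<in> verts G" and ne: "a \<noteq> b"
  show "\<exists>w\<in>?W. strongly_resolves G w a b"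
  proof (cases "h a \<in> C \<and> h b \<in> C")
    case False
    then show ?thesis using self[OF a b] a b by blast
  next
    case True
    have main: "\<exists>w\<in>?W. strongly_resolves G w x y \<and> strongly_resolves G w y x"
      if "x \<in> verts G" "y \<in> verts G" "h x \<in> C" "h y \<in> C" "h x < h y" for x y
    proof -
      have cmp: "comparable (h x) (h y)" "comparable (h y) (h x)" "x \<noteq> y"
        using that by (auto simp: comparable_def)
      show ?thesis using h_proper[OF that(1)] h_proper[OF that(2)] that(5)
      proof (cases rule: less_distinguished)
        case (1 w)
        then obtain c where c: "c \<in> verts G" "h c = w" using h_surj by blast
        have "c \<in> ?W" using c 1 C that by blast
        then show ?thesis using far[of x y c] c 1 that cmp by blast
      next
        case (2 w)
        then obtain c where c: "c \<in> verts G" "h c = w" using h_surj by blast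
        have "c \<in> ?W" using c 2 C that by blast
        then show ?thesis using far[of y x c] c 2 that cmp by blast
      qed
    qed
    have "h a < h b \<or> h b < h a" using True C[of "h a" "h b"] h_inj[OF a b] ne
      by (auto simp: comparable_def less_le)
    then show ?thesis using main True a b by blast
  qed
qed auto

text \<open>There are \<open>card tuples - 2\<close> vertices, and a smallest resolving set omits
  exactly \<open>rank (E I) - 1\<close> of them, the size of a maximal chain of proper
  tuples.\<close>

theorem sdim_chain_product_graph: "sdim G + rank (E I) + 1 = card tuples"
proof -
  have cV: "card (verts G) = card proper" using bij by (rule bij_betw_same_card)
  obtain C where C: "C \<subseteq> proper" "\<And>u v. u \<in> C \<Longrightarrow> v \<in> C \<Longrightarrow> comparable u v" "card C + 1 = rank (E I)"
    using exists_max_chain by blast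
  let ?W = "{a \<in> verts G. h a \<notin> C}"
  have "bij_betw h ?W (proper - C)"
    using bij by (auto simp: bij_betw_def intro: inj_on_subset)
  then have "card ?W = card (proper - C)" by (rule bij_betw_same_card)
  also have "\<dots> = card proper - card C"
    using C finite_proper by (meson card_Diff_subset finite_subset)
  finally have cW: "card ?W = card proper - card C" .
  have "sdim G = card proper - card C"
    unfolding sdim_def
  proof (rule Least_equality)
    show "\<exists>W. finite W \<and> strong_resolving_set G W \<and> card W = card proper - card C"
      using chain_complement_resolving[OF C(2)] cW finite_verts by (intro exI[of _ ?W]) auto
    fix k assume "\<exists>W. finite W \<and> strong_resolving_set G W \<and> card W = k"
    then obtain W where W: "finite W" "strong_resolving_set G W" "card W = k" by blast
    have "W \<subseteq> verts G" using W(2) by (simp add: strong_resolving_set_def)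
    then have "card (verts G - W) = card (verts G) - k" using W by (simp add: card_Diff_subset)
    then show "card proper - card C \<le> k" using card_unresolved[OF W(2)] C(3) cV by simp
  qed
  moreover have "card C \<le> card proper" using C finite_proper by (simp add: card_mono)
  ultimately show ?thesis using C(3) card_proper by simp
qed

end

section \<open>Ideals of a product of chain rings\<close>

definition order_iso_betw :: "('a::order \<Rightarrow> 'b::order) \<Rightarrow> 'a set \<Rightarrow> 'b set \<Rightarrow> bool" where
  "order_iso_betw f A B \<longleftrightarrow> f ` A = B \<and> (\<forall>x\<in>A. \<forall>y\<in>A. f x \<le> f y \<longleftrightarrow> x \<le> y)"

lemma order_iso_betw_bij: "order_iso_betw f A B \<Longrightarrow> bij_betw f A B"
  unfolding order_iso_betw_def bij_betw_def inj_on_def by (metis order.antisym order_refl)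

lemma order_iso_betw_inv:
  assumes "order_iso_betw f A B"
  shows "order_iso_betw (inv_into A f) B A"
proof -
  have b: "bij_betw f A B" using assms by (rule order_iso_betw_bij)
  have "inv_into A f x \<le> inv_into A f y \<longleftrightarrow> x \<le> y" if "x \<in> B" "y \<in> B" for x y
  proof -
    have "inv_into A f x \<in> A" "inv_into A f y \<in> A" "f (inv_into A f x) = x" "f (inv_into A f y) = y"
      using that b by (auto simp: bij_betw_def inv_into_into f_inv_into_f)
    then show ?thesis using assms unfolding order_iso_betw_def by metis
  qed
  moreover have "inv_into A f ` B = A" using b by (auto simp: bij_betw_def)
  ultimately show ?thesis by (simp add: order_iso_betw_def)
qed

text \<open>Counting the elements strictly below is strictly increasing on a finite chain and hits
  each of \<open>0\<close>, ..., \<open>n\<close>; its inverse is the isomorphism sought.\<close>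

lemma finite_chain_order_iso:
  fixes A :: "'a::order set"
  assumes fin: "finite A" and chain: "\<And>x y. x \<in> A \<Longrightarrow> y \<in> A \<Longrightarrow> x \<le> y \<or> y \<le> x"
    and card: "card A = Suc n"
  obtains c where "order_iso_betw c {..n} A"
proof -
  define r where "r x = card {y \<in> A. y < x}" for x
  have less: "r x < r y" if "x \<in> A" "y \<in> A" "x < y" for x y
    unfolding r_def
  proof (rule psubset_card_mono)
    show "{z \<in> A. z < x} \<subset> {z \<in> A. z < y}" using that by (auto intro: less_trans)
  qed (use fin in simp)
  have le: "r x \<le> r y \<longleftrightarrow> x \<le> y" if "x \<in> A" "y \<in> A" for x y
    using less[of x y] less[of y x] chain[of x y] that by (metis le_less not_le order.order_iff_strict)
  have inj: "inj_on r A" by (rule inj_onI) (metis le order.antisym order_refl)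
  have "r ` A \<subseteq> {..n}"
  proof
    fix k assume "k \<in> r ` A"
    then obtain x where x: "x \<in> A" "k = r x" by blast
    have "r x < card A" unfolding r_def by (rule psubset_card_mono[OF fin]) (use x in auto)
    then show "k \<in> {..n}" using x card by simp
  qed
  then have "r ` A = {..n}"
    by (rule card_subset_eq[rotated]) (simp_all add: card_image[OF inj] card)
  then have "order_iso_betw r A {..n}" using le by (simp add: order_iso_betw_def)
  then show thesis using order_iso_betw_inv that by blast
qed

section \<open>Ideals of products of rings\<close>

lemma (in ring) ideal_from_closure:
  assumes sub: "I \<subseteq> carrier R" and zero: "\<zero> \<in> I"
    and add: "\<And>a b. a \<in> I \<Longrightarrow> b \<in> I \<Longrightarrow> a \<oplus> b \<in> I"
    and mult: "\<And>a x. a \<in> I \<Longrightarrow> x \<in> carrier R \<Longrightarrow> x \<otimes> a \<in> I \<and> a \<otimes> x \<in> I"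
  shows "ideal I R"
proof (rule idealI)
  show "ring R" by (rule ring_axioms)
  show "subgroup I (add_monoid R)"
  proof (rule add.subgroupI)
    \<comment> \<open>Additive inverses arise by multiplication with
      \<open>\<ominus> \<one>\<close>.\<close>
    show "\<ominus> a \<in> I" if "a \<in> I" for a
      using mult[OF that, of "\<ominus> \<one>"] that sub by (auto simp: l_minus)
  qed (use sub zero add in auto)
qed (use mult in auto)

lemma ideal_ring_iso_image:
  assumes "ring R" "ring S" and h: "h \<in> ring_iso R S" and I: "ideal I R"
  shows "ideal (h ` I) S"
proof -
  interpret R: ring R by fact
  interpret S: ring S by fact
  interpret I: ideal I R by fact
  note I_add = additive_subgroup.a_closed[OF I.is_additive_subgroup]
    and I_zero = additive_subgroup.zero_closed[OF I.is_additive_subgroup]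
  have hom: "h \<in> ring_hom R S" and bij: "bij_betw h (carrier R) (carrier S)"
    using h by (auto simp: ring_iso_def)
  interpret H: ring_hom_ring R S h by unfold_locales (rule hom)
  show ?thesis
  proof (rule S.ideal_from_closure)
    show "h ` I \<subseteq> carrier S" using I.a_subset by auto
    show "\<zero>\<^bsub>S\<^esub> \<in> h ` I" using I_zero H.hom_zero by (metis imageI)
    show "a \<oplus>\<^bsub>S\<^esub> b \<in> h ` I" if ab: "a \<in> h ` I" "b \<in> h ` I" for a b
    proof -
      obtain x y where xy: "x \<in> I" "y \<in> I" "a = h x" "b = h y" using ab by blast
      have "h (x \<oplus>\<^bsub>R\<^esub> y) \<in> h ` I" using I_add[OF xy(1,2)] by (rule imageI)
      then show ?thesis using H.hom_add[OF I.Icarr I.Icarr] xy by metis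
    qed
    show "x \<otimes>\<^bsub>S\<^esub> a \<in> h ` I \<and> a \<otimes>\<^bsub>S\<^esub> x \<in> h ` I" if a: "a \<in> h ` I" and x: "x \<in> carrier S" for a x
    proof -
      obtain a' where a': "a' \<in> I" "a = h a'" using a by blast
      obtain x' where x': "x' \<in> carrier R" "x = h x'" using x bij by (metis bij_betw_imp_surj_on imageE)
      have "x \<otimes>\<^bsub>S\<^esub> a = h (x' \<otimes>\<^bsub>R\<^esub> a')" "a \<otimes>\<^bsub>S\<^esub> x = h (a' \<otimes>\<^bsub>R\<^esub> x')"
        unfolding a'(2) x'(2) by (simp_all only: H.hom_mult[OF x'(1) I.Icarr[OF a'(1)]]
          H.hom_mult[OF I.Icarr[OF a'(1)] x'(1)])
      then show ?thesis using I.I_l_closed[OF a'(1) x'(1)] I.I_r_closed[OF a'(1) x'(1)] by blast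
    qed
  qed
qed

lemma ideal_ring_iso_vimage:
  assumes "ring R" "ring S" and h: "h \<in> ring_iso R S" and J: "ideal J S"
  shows "ideal {x \<in> carrier R. h x \<in> J} R"
proof -
  interpret R: ring R by fact
  interpret S: ring S by fact
  interpret J: ideal J S by fact
  have hom: "h \<in> ring_hom R S" using h by (auto simp: ring_iso_def)
  interpret H: ring_hom_ring R S h by unfold_locales (rule hom)
  show ?thesis
    by (rule R.ideal_from_closure)
      (auto simp: J.I_l_closed J.I_r_closed additive_subgroup.a_closed[OF J.is_additive_subgroup]
        additive_subgroup.zero_closed[OF J.is_additive_subgroup])
qed

lemma RDirProd_ops:
  "\<zero>\<^bsub>RDirProd R S\<^esub> = (\<zero>\<^bsub>R\<^esub>, \<zero>\<^bsub>S\<^esub>)"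
  "(a, b) \<oplus>\<^bsub>RDirProd R S\<^esub> (c, d) = (a \<oplus>\<^bsub>R\<^esub> c, b \<oplus>\<^bsub>S\<^esub> d)"
  "(a, b) \<otimes>\<^bsub>RDirProd R S\<^esub> (c, d) = (a \<otimes>\<^bsub>R\<^esub> c, b \<otimes>\<^bsub>S\<^esub> d)"
  by (simp_all add: RDirProd_def DirProd_def monoid.defs)

lemma ideal_RDirProdI:
  assumes "ring R" "ring S" "ideal J R" "ideal K S"
  shows "ideal (J \<times> K) (RDirProd R S)"
proof -
  interpret P: ring "RDirProd R S" using assms by (intro RDirProd_ring)
  interpret J: ideal J R by fact
  interpret K: ideal K S by fact
  show ?thesis
    by (rule P.ideal_from_closure)
      (auto simp: RDirProd_ops RDirProd_carrier J.Icarr K.Icarr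
        J.I_l_closed J.I_r_closed additive_subgroup.a_closed[OF J.is_additive_subgroup]
        additive_subgroup.zero_closed[OF J.is_additive_subgroup]
        K.I_l_closed K.I_r_closed additive_subgroup.a_closed[OF K.is_additive_subgroup]
        additive_subgroup.zero_closed[OF K.is_additive_subgroup])
qed

text \<open>Multiplying by \<open>(1, 0)\<close> and \<open>(0, 1)\<close> separates
  \<open>(a, b)\<close> into \<open>(a, 0)\<close> and \<open>(0, b)\<close>, so an ideal is the
  product of its two projections.\<close>

lemma ideal_RDirProdE:
  assumes "ring R" "ring S" and I: "ideal I (RDirProd R S)"
  obtains J K where "ideal J R" "ideal K S" "I = J \<times> K"
proof
  interpret R: ring R by fact
  interpret S: ring S by fact
  interpret I: ideal I "RDirProd R S" by fact
  note ops = RDirProd_ops[of R S]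
  have car: "a \<in> carrier R" "b \<in> carrier S" if "(a, b) \<in> I" for a b
    using I.Icarr[OF that] by (auto simp: RDirProd_carrier)
  have I_add: "(a \<oplus>\<^bsub>R\<^esub> c, b \<oplus>\<^bsub>S\<^esub> d) \<in> I" if "(a, b) \<in> I" "(c, d) \<in> I" for a b c d
    using additive_subgroup.a_closed[OF I.is_additive_subgroup that] by (simp add: ops)
  have I_l: "(x \<otimes>\<^bsub>R\<^esub> a, y \<otimes>\<^bsub>S\<^esub> b) \<in> I" if "(a, b) \<in> I" "x \<in> carrier R" "y \<in> carrier S" for a b x y
    using I.I_l_closed[OF that(1), of "(x, y)"] that by (simp add: ops RDirProd_carrier)
  have I_r: "(a \<otimes>\<^bsub>R\<^esub> x, b \<otimes>\<^bsub>S\<^esub> y) \<in> I" if "(a, b) \<in> I" "x \<in> carrier R" "y \<in> carrier S" for a b x y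
    using I.I_r_closed[OF that(1), of "(x, y)"] that by (simp add: ops RDirProd_carrier)
  have zero: "(\<zero>\<^bsub>R\<^esub>, \<zero>\<^bsub>S\<^esub>) \<in> I" using additive_subgroup.zero_closed[OF I.is_additive_subgroup] by (simp add: ops)
  have left: "(a, \<zero>\<^bsub>S\<^esub>) \<in> I" and right: "(\<zero>\<^bsub>R\<^esub>, b) \<in> I" if "(a, b) \<in> I" for a b
    using I_l[OF that, of "\<one>\<^bsub>R\<^esub>" "\<zero>\<^bsub>S\<^esub>"] I_l[OF that, of "\<zero>\<^bsub>R\<^esub>" "\<one>\<^bsub>S\<^esub>"] car[OF that] by simp_all
  show "ideal (fst ` I) R"
  proof (rule R.ideal_from_closure)
    show "fst ` I \<subseteq> carrier R" using car by auto
    show "\<zero>\<^bsub>R\<^esub> \<in> fst ` I" using zero by force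
    show "a \<oplus>\<^bsub>R\<^esub> b \<in> fst ` I" if "a \<in> fst ` I" "b \<in> fst ` I" for a b
      using that I_add by force
    show "x \<otimes>\<^bsub>R\<^esub> a \<in> fst ` I \<and> a \<otimes>\<^bsub>R\<^esub> x \<in> fst ` I" if "a \<in> fst ` I" "x \<in> carrier R" for a x
      using that I_l[of a _ x "\<zero>\<^bsub>S\<^esub>"] I_r[of a _ x "\<zero>\<^bsub>S\<^esub>"] by force
  qed
  show "ideal (snd ` I) S"
  proof (rule S.ideal_from_closure)
    show "snd ` I \<subseteq> carrier S" using car by auto
    show "\<zero>\<^bsub>S\<^esub> \<in> snd ` I" using zero by force
    show "a \<oplus>\<^bsub>S\<^esub> b \<in> snd ` I" if "a \<in> snd ` I" "b \<in> snd ` I" for a b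
      using that I_add by force
    show "x \<otimes>\<^bsub>S\<^esub> a \<in> snd ` I \<and> a \<otimes>\<^bsub>S\<^esub> x \<in> snd ` I" if "a \<in> snd ` I" "x \<in> carrier S" for a x
      using that I_l[of _ a "\<zero>\<^bsub>R\<^esub>" x] I_r[of _ a "\<zero>\<^bsub>R\<^esub>" x] by force
  qed
  show "I = fst ` I \<times> snd ` I"
  proof (intro equalityI subsetI)
    fix p assume "p \<in> fst ` I \<times> snd ` I"
    then obtain a b c d where p: "p = (a, d)" "(a, b) \<in> I" "(c, d) \<in> I" by force
    have "(a \<oplus>\<^bsub>R\<^esub> \<zero>\<^bsub>R\<^esub>, \<zero>\<^bsub>S\<^esub> \<oplus>\<^bsub>S\<^esub> d) \<in> I" using I_add[OF left[OF p(2)] right[OF p(3)]] .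
    then show "p \<in> I" using car[OF p(2)] car[OF p(3)] p(1) by simp
  qed (auto simp: mem_Times_iff)
qed

lemma set_Cons_eq_image: "set_Cons J K = (\<lambda>(a, as). a # as) ` (J \<times> K)"
  by (auto simp: set_Cons_def)

lemma RDirProd_list_ring:
  "\<forall>R\<in>set Rs. ring R \<Longrightarrow> ring (RDirProd_list Rs)"
  by (intro RDirProd_list_is_ring) simp

lemma ideal_RDirProd_listI:
  assumes "list_all2 ideal Js Rs" "\<forall>R\<in>set Rs. ring R"
  shows "ideal (listset Js) (RDirProd_list Rs)"
  using assms
proof (induction Js Rs rule: list_all2_induct)
  case Nil
  interpret N: ring "RDirProd_list []" by (rule RDirProd_list_ring) simp
  show ?case using N.oneideal by simp
next
  case (Cons J Js R Rs)
  have rings: "ring R" "ring (RDirProd_list Rs)" using Cons.prems RDirProd_list_ring by auto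
  have "ideal (J \<times> listset Js) (RDirProd R (RDirProd_list Rs))"
    using Cons by (intro ideal_RDirProdI rings) auto
  from ideal_ring_iso_image[OF RDirProd_ring[OF rings] RDirProd_list_ring[OF Cons.prems]
      RDirProd_list_iso1 this]
  show ?case by (simp add: set_Cons_eq_image)
qed

text \<open>The isomorphism \<open>(a, as)\<close> to \<open>a # as\<close> pulls the ideal back to
  a binary product, where \<open>ideal_RDirProdE\<close> splits off the first factor.\<close>

lemma ideal_RDirProd_listE:
  assumes "ideal I (RDirProd_list Rs)" "\<forall>R\<in>set Rs. ring R"
  shows "\<exists>Js. list_all2 ideal Js Rs \<and> I = listset Js"
  using assms
proof (induction Rs arbitrary: I)
  case Nil
  have "I \<subseteq> {[]}" using ideal.Icarr[OF Nil(1)] by auto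
  moreover have "[] \<in> I"
    using additive_subgroup.zero_closed[OF ideal.axioms(1)[OF Nil(1)]]
    unfolding RDirProd_list_zero by simp
  ultimately
  have "I = listset []" by auto
  then show ?case by blast
next
  case (Cons R Rs)
  let ?h = "\<lambda>(a, as). a # as"
  have rings: "ring R" "ring (RDirProd_list Rs)" using Cons.prems RDirProd_list_ring by auto
  have ringP: "ring (RDirProd R (RDirProd_list Rs))" using rings by (rule RDirProd_ring)
  have ringL: "ring (RDirProd_list (R # Rs))" using Cons.prems(2) by (rule RDirProd_list_ring)
  let ?I = "{x \<in> carrier (RDirProd R (RDirProd_list Rs)). ?h x \<in> I}"
  have "ideal ?I (RDirProd R (RDirProd_list Rs))"
    using ideal_ring_iso_vimage[OF ringP ringL RDirProd_list_iso1 Cons.prems(1)] .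
  then obtain J K where JK: "ideal J R" "ideal K (RDirProd_list Rs)" "?I = J \<times> K"
    using ideal_RDirProdE rings by blast
  obtain Js where Js: "list_all2 ideal Js Rs" "K = listset Js" using Cons.IH[OF JK(2)] Cons.prems by auto
  have "I \<subseteq> carrier (RDirProd_list (R # Rs))" using ideal.Icarr[OF Cons.prems(1)] by auto
  then have "I = ?h ` ?I" unfolding RDirProd_list_carrier RDirProd_carrier by auto
  then have "I = listset (J # Js)" using JK(3) Js(2) by (simp add: set_Cons_eq_image)
  then show ?case using JK(1) Js(1) by (intro exI[of _ "J # Js"]) simp
qed

lemma listset_nonempty: "\<forall>J\<in>set Js. J \<noteq> {} \<Longrightarrow> listset Js \<noteq> {}"
  by (induction Js) (auto simp: set_Cons_def)

text \<open>An empty side would make the whole box empty; with nonempty sides, inclusion of boxes is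
  read off side by side. Ideals qualify because they contain zero.\<close>

lemma listset_subset_iff:
  assumes "length Js = length Ks" "\<forall>J\<in>set Js. J \<noteq> {}"
  shows "listset Js \<subseteq> listset Ks \<longleftrightarrow> list_all2 (\<subseteq>) Js Ks"
  using assms
proof (induction Js Ks rule: list_induct2)
  case (Cons J Js K Ks)
  then have ne: "listset Js \<noteq> {}" "J \<noteq> {}" by (auto intro!: listset_nonempty)
  have "listset (J # Js) \<subseteq> listset (K # Ks) \<longleftrightarrow> J \<times> listset Js \<subseteq> K \<times> listset Ks"
    by (auto simp: set_Cons_def)
  also have "\<dots> \<longleftrightarrow> J \<subseteq> K \<and> listset Js \<subseteq> listset Ks" using ne by (auto simp: times_subset_iff)
  finally show ?case using Cons by simp
qed simp

section \<open>Ideals of a local Artinian principal ideal ring\<close>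

context principal_ideal_ring
begin

lemma ideal_generator:
  assumes "ideal I R"
  obtains a where "a \<in> carrier R" "I = PIdl a"
  using principalideal.generate[OF all_principal[OF assms]] cgenideal_eq_genideal by metis

lemma noetherian: "noetherian_ring R"
proof (rule noetherian_ringI)
  fix I assume "ideal I R"
  from principalideal.generate[OF all_principal[OF this]]
  obtain i where "i \<in> carrier R" "I = Idl {i}" by blast
  then show "\<exists>A \<subseteq> carrier R. finite A \<and> I = Idl A" by (intro exI[of _ "{i}"]) simp
qed

text \<open>Zorn's lemma on the proper ideals above \<open>I\<close>. The ring is noetherian, so a
  nonempty chain of ideals contains its union, which is then an upper bound.\<close>

lemma exists_maximal_ideal:
  assumes I: "ideal I R" "I \<noteq> carrier R"
  obtains M where "maximalideal M R" "I \<subseteq> M"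
proof -
  define A where "A = {J. ideal J R \<and> I \<subseteq> J \<and> J \<noteq> carrier R}"
  have "\<exists>M\<in>A. \<forall>J\<in>A. M \<subseteq> J \<longrightarrow> J = M"
  proof (rule subset_Zorn)
    fix C assume C: "subset.chain A C"
    show "\<exists>U\<in>A. \<forall>J\<in>C. J \<subseteq> U"
    proof (cases "C = {}")
      case True
      then show ?thesis using I by (auto simp: A_def)
    next
      case False
      have "subset.chain {I. ideal I R} C" using C by (auto simp: pred_on.chain_def A_def)
      then have "\<Union>C \<in> C" using noetherian_ring.ideal_chain_is_trivial[OF noetherian False] by blast
      then show ?thesis using C by (auto simp: pred_on.chain_def)
    qed
  qed
  then obtain M where M: "M \<in> A" "\<And>J. J \<in> A \<Longrightarrow> M \<subseteq> J \<Longrightarrow> J = M" by blast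
  have "maximalideal M R"
  proof (rule maximalidealI)
    show "J = M \<or> J = carrier R" if "ideal J R" "M \<subseteq> J" for J
      using M(1) M(2)[of J] that by (auto simp: A_def)
  qed (use M(1) in \<open>auto simp: A_def\<close>)
  then show thesis using M that by (auto simp: A_def)
qed

end

context local_artinian_pir
begin

lemma PIdl_subset: "a \<in> carrier R \<Longrightarrow> x \<in> carrier R \<Longrightarrow> PIdl (x \<otimes> a) \<subseteq> PIdl a"
  by (rule cgenideal_minimal[OF cgenideal_ideal]) (auto simp: cgenideal_def)

text \<open>A non-unit generates a proper ideal, which lies in a maximal ideal and thus in the only
  one.\<close>

lemma maximal_generator:
  obtains p where "p \<in> carrier R" "maximalideal (PIdl p) R" "carrier R - PIdl p \<subseteq> Units R"
proof -
  obtain M where M: "maximalideal M R" "\<And>N. maximalideal N R \<Longrightarrow> N = M"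
    using unique_maximal by blast
  obtain p where p: "p \<in> carrier R" "M = PIdl p"
    using ideal_generator maximalideal.axioms(1)[OF M(1)] by blast
  have "x \<in> Units R" if x: "x \<in> carrier R" "x \<notin> M" for x
  proof (rule ccontr)
    assume nu: "x \<notin> Units R"
    have "PIdl x \<noteq> carrier R"
    proof
      assume "PIdl x = carrier R"
      then obtain y where "y \<in> carrier R" "\<one> = y \<otimes> x" by (auto simp: cgenideal_def)
      then show False using nu x by (auto simp: Units_def m_comm)
    qed
    then obtain N where "maximalideal N R" "PIdl x \<subseteq> N"
      using exists_maximal_ideal cgenideal_ideal x by metis
    then show False using M(2) x cgenideal_self by blast
  qed
  then have "carrier R - PIdl p \<subseteq> Units R" using p by blast
  moreover have "maximalideal (PIdl p) R" using M(1) p by simp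
  ultimately show thesis using that p(1) by blast
qed

text \<open>With \<open>p\<close> generating the maximal ideal, some power \<open>p [^] N\<close>
  vanishes. Any \<open>x\<close> is a unit times a power of \<open>p\<close>, or zero, and so
  generates the same ideal as that power.\<close>

lemma ideals_powers:
  obtains p N where "p \<in> carrier R" "{I. ideal I R} \<subseteq> (\<lambda>k. PIdl (p [^] (k::nat))) ` {..N}"
proof -
  obtain p where p: "p \<in> carrier R" and max: "maximalideal (PIdl p) R"
    and units: "carrier R - PIdl p \<subseteq> Units R"
    using maximal_generator .
  interpret M: maximalideal "PIdl p" R by (rule max)
  have one: "\<one> \<notin> PIdl p" using M.one_imp_carrier M.I_notcarr by blast
  let ?P = "\<lambda>k::nat. PIdl (p [^] k)"
  have pk: "p [^] k \<in> carrier R" for k :: nat using p by simp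
  have "\<exists>N. \<forall>k\<ge>N. ?P k = ?P N"
  proof (rule descending_chain)
    show "ideal (?P k) R" for k by (rule cgenideal_ideal[OF pk])
    show "?P (Suc k) \<subseteq> ?P k" for k using PIdl_subset[OF pk p, of k] p by (simp add: m_comm)
  qed
  then obtain N where N: "\<And>k. k \<ge> N \<Longrightarrow> ?P k = ?P N" by blast
  have "p [^] N \<in> ?P (Suc N)" using N[of "Suc N"] cgenideal_self[OF pk, of N] by simp
  then obtain a where a: "a \<in> carrier R" "p [^] N = a \<otimes> (p [^] Suc N)"
    unfolding cgenideal_def by blast
  \<comment> \<open>From \<open>p [^] N = a \<otimes> p [^] Suc N\<close>, the element
    \<open>u\<close> annihilates \<open>p [^] N\<close>. It is a unit, for otherwise
    \<open>\<one> = u \<oplus> a \<otimes> p\<close> would lie in the maximal ideal.\<close>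
  define u where "u = \<one> \<ominus> a \<otimes> p"
  have u: "u \<in> carrier R" using a(1) p by (simp add: u_def)
  have "u \<notin> PIdl p"
  proof
    assume "u \<in> PIdl p"
    moreover have "a \<otimes> p \<in> PIdl p" using a(1) unfolding cgenideal_def by blast
    ultimately have "u \<oplus> a \<otimes> p \<in> PIdl p" by (rule additive_subgroup.a_closed[OF M.is_additive_subgroup])
    moreover have "u \<oplus> a \<otimes> p = \<one>"
      using a(1) p unfolding u_def a_minus_def by (simp add: a_assoc l_neg)
    ultimately show False using one by simp
  qed
  then have uU: "u \<in> Units R" using units u by blast
  have "a \<otimes> p \<otimes> p [^] N = a \<otimes> (p [^] Suc N)" using a(1) p by (simp add: m_assoc m_comm)
  then have "u \<otimes> p [^] N = p [^] N \<ominus> a \<otimes> (p [^] Suc N)"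
    unfolding u_def a_minus_def using l_distr[of \<one> "\<ominus> (a \<otimes> p)" "p [^] N"] a(1) p
    by (simp add: l_minus del: nat_pow_Suc)
  also have "\<dots> = \<zero>" using a pk r_right_minus_eq m_closed by metis
  finally have "u \<otimes> p [^] N = u \<otimes> \<zero>" using u by simp
  then have pN: "p [^] N = \<zero>" using Units_l_cancel[OF uU pk zero_closed] by blast
  have "I \<in> ?P ` {..N}" if I: "ideal I R" for I
  proof -
    obtain x where x: "x \<in> carrier R" "I = PIdl x" using ideal_generator[OF I] .
    \<comment> \<open>The largest \<open>k\<close> in \<open>K\<close> extracts as many factors
      \<open>p\<close> as possible: for \<open>k < N\<close> the cofactor \<open>b\<close> is
      outside the maximal ideal, hence a unit, and for \<open>k = N\<close> already
      \<open>x = \<zero>\<close>.\<close>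
    define K where "K = {k. k \<le> N \<and> x \<in> ?P k}"
    have "x = x \<otimes> p [^] (0::nat)" using x(1) by simp
    then have "x \<in> ?P 0" unfolding cgenideal_def using x(1) by blast
    then have "0 \<in> K" by (simp add: K_def)
    moreover have finK: "finite K" by (simp add: K_def)
    ultimately have mK: "Max K \<in> K" using Max_in by blast
    define k where "k = Max K"
    have k: "k \<le> N" "x \<in> ?P k" using mK by (auto simp: K_def k_def)
    obtain b where b: "b \<in> carrier R" "x = b \<otimes> p [^] k" using k(2) unfolding cgenideal_def by blast
    have "PIdl x = ?P k"
    proof (cases "k = N")
      case True
      then have "x = \<zero>" using b pN by simp
      then show ?thesis using True pN by simp
    next
      case False
      have "b \<notin> PIdl p"
      proof
        assume "b \<in> PIdl p"
        then obtain c where "c \<in> carrier R" "b = c \<otimes> p" unfolding cgenideal_def by blast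
        then have "c \<in> carrier R" "x = c \<otimes> p [^] Suc k"
          using b(2) p by (simp_all add: m_assoc m_comm)
        then have "x \<in> ?P (Suc k)" unfolding cgenideal_def by blast
        then have "Suc k \<in> K" using False k by (simp add: K_def)
        then show False using Max_ge[OF finK] by (fastforce simp: k_def)
      qed
      then have bU: "b \<in> Units R" using units b by blast
      have "p [^] k = inv b \<otimes> x" using b bU pk by (simp add: m_assoc[symmetric])
      then have "?P k \<subseteq> PIdl x" using PIdl_subset[OF x(1), of "inv b"] bU by simp
      moreover have "PIdl x \<subseteq> ?P k" using PIdl_subset[OF pk b(1)] b(2) by simp
      ultimately show ?thesis by blast
    qed
    then show ?thesis using k x by blast
  qed
  then show thesis using that[OF p] by blast
qed

lemma finite_ideals: "finite {I. ideal I R}"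
  using ideals_powers by (metis finite_atMost finite_imageI finite_subset)

lemma ideals_chain:
  assumes "ideal I R" "ideal J R"
  shows "I \<subseteq> J \<or> J \<subseteq> I"
proof -
  obtain p N where p: "p \<in> carrier R" and sub: "{I. ideal I R} \<subseteq> (\<lambda>k. PIdl (p [^] (k::nat))) ` {..N}"
    using ideals_powers .
  obtain k l :: nat where kl: "I = PIdl (p [^] k)" "J = PIdl (p [^] l)" using sub assms by blast
  have "PIdl (p [^] (j::nat)) \<subseteq> PIdl (p [^] (i::nat))" if "i \<le> j" for i j
  proof -
    have "p [^] j = p [^] (j - i) \<otimes> p [^] i" using p that by (simp add: nat_pow_mult)
    then show ?thesis using PIdl_subset[of "p [^] i" "p [^] (j - i)"] p by simp
  qed
  then show ?thesis using kl by (metis nat_le_linear)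
qed

lemma zero_neq_carrier: "{\<zero>} \<noteq> carrier R"
proof -
  obtain M where "maximalideal M R" using unique_maximal by blast
  then interpret M: maximalideal M R .
  have "{\<zero>} \<subseteq> M" using additive_subgroup.zero_closed[OF M.is_additive_subgroup] by simp
  then show ?thesis using M.I_notcarr M.a_subset by blast
qed

lemma card_ideals: "card {I. ideal I R} = card (nontrivial_ideals R) + 2"
proof -
  have "{I. ideal I R} = nontrivial_ideals R \<union> {{\<zero>}, carrier R}"
    using zeroideal oneideal by (auto simp: nontrivial_ideals_def)
  moreover have "nontrivial_ideals R \<inter> {{\<zero>}, carrier R} = {}" by (auto simp: nontrivial_ideals_def)
  moreover have "finite (nontrivial_ideals R)"
    using finite_ideals by (rule finite_subset[rotated]) (auto simp: nontrivial_ideals_def)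
  ultimately show ?thesis using zero_neq_carrier by (simp add: card_Un_disjoint)
qed

text \<open>The maximal ideal is a witness: if it were zero, the ring would be a field.\<close>

lemma nontrivial_ideals_nonempty:
  assumes "\<not> field R"
  shows "card (nontrivial_ideals R) > 0"
proof -
  obtain M where M: "maximalideal M R" using unique_maximal by blast
  then interpret M: maximalideal M R .
  have "M \<noteq> {\<zero>}" using zeromaximalideal_eq_field M assms by blast
  then have "M \<in> nontrivial_ideals R"
    using M.is_ideal M.I_notcarr by (auto simp: nontrivial_ideals_def)
  moreover have "finite (nontrivial_ideals R)"
    using finite_ideals by (rule finite_subset[rotated]) (auto simp: nontrivial_ideals_def)
  ultimately show ?thesis by (auto simp: card_gt_0_iff)
qed

lemma ideals_order_iso:
  obtains c where "order_iso_betw c {..card (nontrivial_ideals R) + 1} {I. ideal I R}"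
  using finite_chain_order_iso[OF finite_ideals, of "card (nontrivial_ideals R) + 1"]
    ideals_chain card_ideals by auto

end

section \<open>The strong metric dimension\<close>

theorem theorem3p3:
  fixes R :: "('a, 'r) ring_scheme"
    and Rs :: "nat \<Rightarrow> ('b, 's) ring_scheme"
    and m :: nat
    and n :: "nat \<Rightarrow> nat"
  assumes "m \<ge> 2"
    and "cring R"
    and "R \<simeq> RDirProd_list (map Rs [1..<Suc m])"
    and "\<And>i. i \<in> {1..m} \<Longrightarrow> local_artinian_pir (Rs i)"
    and "\<And>i. i \<in> {1..m} \<Longrightarrow> \<not> field (Rs i)"
    and "\<And>i. i \<in> {1..m} \<Longrightarrow> n i = card (nontrivial_ideals (Rs i))"
  shows "int (sdim (with_proj (inclusion_ideal_graph R))) =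
    (\<Prod>i=1..m. int (n i) + 2) - (\<Sum>i=1..m. int (n i)) - int m - 1"
proof -
  \<comment> \<open>The \<open>n i + 2\<close> ideals of a factor, with zero and the whole ring
    included, are numbered from 0 to \<open>n i + 1\<close>.\<close>
  define L where "L i = n i + 1" for i
  interpret chain_product m L
  proof
    show "L i \<ge> 2" if "i \<in> {1..m}" for i
      using local_artinian_pir.nontrivial_ideals_nonempty[OF assms(4)[OF that] assms(5)[OF that]]
        assms(6)[OF that] by (simp add: L_def)
  qed (rule assms(1))
  interpret R: cring R by (rule assms(2))
  let ?P = "RDirProd_list (map Rs [1..<Suc m])"
  have set_I: "set [1..<Suc m] = I" by auto
  have rings: "\<forall>S\<in>set (map Rs [1..<Suc m]). ring S"
    unfolding set_map set_I
    using assms(4) local_artinian_pir.axioms(2) artinian_ring.axioms(1) cring.axioms(1) by blast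
  interpret P: ring ?P using rings by (rule RDirProd_list_ring)
  obtain h where h: "h \<in> ring_iso R ?P" using assms(3) unfolding is_ring_iso_def by blast
  then have h_bij: "h ` carrier R = carrier ?P" "inj_on h (carrier R)"
    by (auto simp: ring_iso_def bij_betw_def)
  have "\<exists>c. order_iso_betw c {..L i} {J. ideal J (Rs i)}" if "i \<in> I" for i
    using local_artinian_pir.ideals_order_iso[OF assms(4)[OF that]] assms(6)[OF that]
    unfolding L_def by metis
  then have "\<exists>c. \<forall>i\<in>I. order_iso_betw (c i) {..L i} {J. ideal J (Rs i)}"
    by (intro bchoice ballI)
  then obtain c where c: "\<And>i. i \<in> I \<Longrightarrow> order_iso_betw (c i) {..L i} {J. ideal J (Rs i)}" by blast
  have c_ideal: "ideal (c i (f i)) (Rs i)" if "f \<in> tuples" "i \<in> I" for f i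
    using c[OF that(2)] tuples_le_L[OF that] unfolding order_iso_betw_def by blast
  define Js where "Js f = map (\<lambda>i. c i (f i)) [1..<Suc m]" for f :: "nat \<Rightarrow> nat"
  have Js_ideal: "list_all2 ideal (Js f) (map Rs [1..<Suc m])" if "f \<in> tuples" for f
    unfolding Js_def list_all2_map1 list_all2_map2 list_all2_same set_I using c_ideal[OF that] by blast
  have Js_le: "listset (Js f) \<subseteq> listset (Js g) \<longleftrightarrow> f \<le> g" if f: "f \<in> tuples" and g: "g \<in> tuples" for f g
  proof -
    have "c i (f i) \<noteq> {}" if "i \<in> I" for i
      using additive_subgroup.zero_closed[OF ideal.axioms(1)[OF c_ideal[OF f that]]] by blast
    then have "\<forall>J\<in>set (Js f). J \<noteq> {}" unfolding Js_def set_map set_I by blast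
    then have "listset (Js f) \<subseteq> listset (Js g) \<longleftrightarrow> list_all2 (\<subseteq>) (Js f) (Js g)"
      by (intro listset_subset_iff) (simp_all add: Js_def)
    also have "\<dots> \<longleftrightarrow> (\<forall>i\<in>I. c i (f i) \<subseteq> c i (g i))"
      unfolding Js_def list_all2_map1 list_all2_map2 list_all2_same set_I ..
    also have "\<dots> \<longleftrightarrow> (\<forall>i\<in>I. f i \<le> g i)"
      using c tuples_le_L[OF f] tuples_le_L[OF g] unfolding order_iso_betw_def by (metis atMost_iff)
    finally show ?thesis using tuples_le_iff[OF f g] by simp
  qed
  \<comment> \<open>A tuple \<open>f\<close> picks the ideal at height \<open>f i\<close> in each
    factor; the product of these is pulled back to \<open>R\<close> along \<open>h\<close>.\<close>
  define \<psi> where "\<psi> f = {x \<in> carrier R. h x \<in> listset (Js f)}" for f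
  have Js_carrier: "listset (Js f) \<subseteq> carrier ?P" if "f \<in> tuples" for f
    using ideal.Icarr[OF ideal_RDirProd_listI[OF Js_ideal[OF that] rings]] by blast
  have \<psi>_iso: "order_iso_betw \<psi> tuples {J. ideal J R}"
    unfolding order_iso_betw_def
  proof (intro conjI ballI equalityI subsetI)
    show "J \<in> {J. ideal J R}" if "J \<in> \<psi> ` tuples" for J
      using that ideal_ring_iso_vimage[OF R.ring_axioms P.ring_axioms h
          ideal_RDirProd_listI[OF Js_ideal rings]] by (auto simp: \<psi>_def)
    show "\<psi> f \<le> \<psi> g \<longleftrightarrow> f \<le> g" if f: "f \<in> tuples" and g: "g \<in> tuples" for f g
    proof -
      have img: "h ` \<psi> k = listset (Js k)" if "k \<in> tuples" for k
      proof -
        have "listset (Js k) \<subseteq> h ` carrier R" using Js_carrier[OF that] h_bij(1) by simp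
        then show ?thesis unfolding \<psi>_def by (auto simp only: mem_Collect_eq)
      qed
      have "\<psi> f \<subseteq> \<psi> g \<longleftrightarrow> listset (Js f) \<subseteq> listset (Js g)"
      proof
        show "listset (Js f) \<subseteq> listset (Js g)" if "\<psi> f \<subseteq> \<psi> g"
          using image_mono[OF that, of h] img[OF f] img[OF g] by simp
      qed (auto simp: \<psi>_def)
      then show ?thesis using Js_le[OF f g] by simp
    qed
    show "J \<in> \<psi> ` tuples" if "J \<in> {J. ideal J R}" for J
    proof -
      have J: "ideal J R" using that by simp
      obtain Ks where Ks: "list_all2 ideal Ks (map Rs [1..<Suc m])" "h ` J = listset Ks"
        using ideal_RDirProd_listE[OF ideal_ring_iso_image[OF R.ring_axioms P.ring_axioms h J] rings]
        by blast
      have len: "length Ks = m" using list_all2_lengthD[OF Ks(1)] by simp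
      \<comment> \<open>List positions start at 0, while the factors are numbered from 1.\<close>
      have "ideal (Ks ! (i - 1)) (Rs i)" if "i \<in> I" for i
      proof -
        have "i - 1 < m" using that by auto
        then show ?thesis using list_all2_nthD2[OF Ks(1), of "i - 1"] that by (simp del: upt_Suc)
      qed
      then have "Ks ! (i - 1) \<in> c i ` {..L i}" if "i \<in> I" for i
        using c[OF that] that unfolding order_iso_betw_def by auto
      then have "\<exists>k. k \<le> L i \<and> Ks ! (i - 1) = c i k" if "i \<in> I" for i
        using that by (metis atMost_iff imageE)
      then have "\<exists>f. \<forall>i\<in>I. f i \<le> L i \<and> Ks ! (i - 1) = c i (f i)"
        by (intro bchoice ballI)
      then obtain f where f: "\<And>i. i \<in> I \<Longrightarrow> f i \<le> L i \<and> Ks ! (i - 1) = c i (f i)" by blast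
      have ft: "restrict f I \<in> tuples" using f by (intro restrict_tuples) blast
      have "Js (restrict f I) = Ks"
      proof (rule nth_equalityI)
        show "Js (restrict f I) ! k = Ks ! k" if "k < length (Js (restrict f I))" for k
          using that f[of "Suc k"] by (simp add: Js_def del: upt_Suc)
      qed (simp add: Js_def len del: upt_Suc)
      moreover have "J = {x \<in> carrier R. h x \<in> h ` J}"
        using ideal.Icarr[OF J] h_bij(2) by (auto simp: inj_on_def)
      ultimately have "J = \<psi> (restrict f I)" using Ks(2) by (simp add: \<psi>_def)
      then show ?thesis using ft by blast
    qed
  qed
  define \<phi> where "\<phi> = inv_into tuples \<psi>"
  have \<phi>: "order_iso_betw \<phi> {J. ideal J R} tuples"
    unfolding \<phi>_def using \<psi>_iso by (rule order_iso_betw_inv)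
  have \<phi>_bij: "bij_betw \<phi> {J. ideal J R} tuples" using \<phi> by (rule order_iso_betw_bij)
  have \<phi>_le: "\<phi> J \<le> \<phi> K \<longleftrightarrow> J \<subseteq> K" if "ideal J R" "ideal K R" for J K
    using \<phi> that unfolding order_iso_betw_def by blast
  have \<phi>_surj: "\<exists>J. ideal J R \<and> \<phi> J = f" if "f \<in> tuples" for f
    by (metis (mono_tags) \<phi>_bij bij_betw_imp_surj_on imageE mem_Collect_eq that)
  have \<phi>_tuples: "\<phi> J \<in> tuples" if "ideal J R" for J
    using bij_betwE[OF \<phi>_bij] that by simp
  \<comment> \<open>The least and greatest ideals go to the least and greatest tuples, so that the
    nontrivial ideals correspond to the proper tuples.\<close>
  have \<phi>_zero: "\<phi> {\<zero>\<^bsub>R\<^esub>} = E {}"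
  proof (rule order.antisym)
    obtain J where J: "ideal J R" "\<phi> J = E {}" using \<phi>_surj[OF E_tuples] by blast
    have "{\<zero>\<^bsub>R\<^esub>} \<subseteq> J" using additive_subgroup.zero_closed[OF ideal.axioms(1)[OF J(1)]] by simp
    then show "\<phi> {\<zero>\<^bsub>R\<^esub>} \<le> E {}" using \<phi>_le[OF R.zeroideal J(1)] J(2) by simp
  qed (rule E_empty_le[OF \<phi>_tuples[OF R.zeroideal]])
  have \<phi>_carrier: "\<phi> (carrier R) = E I"
  proof (rule order.antisym)
    obtain J where J: "ideal J R" "\<phi> J = E I" using \<phi>_surj[OF E_tuples] by blast
    have "J \<subseteq> carrier R" using ideal.Icarr[OF J(1)] by blast
    then show "E I \<le> \<phi> (carrier R)" using \<phi>_le[OF J(1) R.oneideal] J(2) by simp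
  qed (rule le_E_I[OF \<phi>_tuples[OF R.oneideal]])
  have V: "nontrivial_ideals R = {J. ideal J R} - {{\<zero>\<^bsub>R\<^esub>}, carrier R}"
    by (auto simp: nontrivial_ideals_def)
  let ?G = "with_proj (inclusion_ideal_graph R)"
  interpret chain_product_graph m L ?G \<phi>
  proof (intro chain_product_graph.intro chain_product_graph_axioms.intro)
    show "chain_product m L" by (rule chain_product_axioms)
    show "wf_digraph ?G" by (rule wf_inclusion_ideal_graph)
    have "bij_betw \<phi> (nontrivial_ideals R) (tuples - \<phi> ` {{\<zero>\<^bsub>R\<^esub>}, carrier R})"
      unfolding V using \<phi>_bij R.zeroideal R.oneideal
      by (auto simp: bij_betw_def inj_on_image_set_diff[of \<phi> "{J. ideal J R}"] intro: inj_on_subset)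
    then show "bij_betw \<phi> (verts ?G) proper"
      by (simp add: proper_def \<phi>_zero \<phi>_carrier inclusion_ideal_graph_def)
    show "(a, b) \<in> arcs_ends ?G \<longleftrightarrow> a \<noteq> b \<and> comparable (\<phi> a) (\<phi> b)"
      if "a \<in> verts ?G" "b \<in> verts ?G" for a b
      using that \<phi>_le[of a b] \<phi>_le[of b a]
      by (auto simp: inclusion_ideal_graph_def nontrivial_ideals_def comparable_def)
  qed
  have "int (sdim ?G) + int (rank (E I)) + 1 = int (card tuples)"
    using sdim_chain_product_graph by linarith
  \<comment> \<open>As \<open>L i = n i + 1\<close>, the rank of the top exceeds the sum of the
    \<open>n i\<close> by \<open>m\<close>, and the chain \<open>{..L i}\<close> contributes the
    factor \<open>n i + 2\<close>.\<close>
  moreover have "int (rank (E I)) = (\<Sum>i=1..m. int (n i)) + int m"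
    unfolding rank_E_I L_def by (simp add: sum.distrib)
  moreover have "int (card tuples) = (\<Prod>i=1..m. int (n i) + 2)"
    unfolding card_tuples L_def by (simp add: add.commute)
  ultimately show ?thesis by linarith
qed

end
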